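(* Let $d\ge1$ and $n\ge2$ be integers, let $\Omega$ be the $d$-dimensional lattice torus of linear size $n$, and let $\beta\ge0$. Let $\boldsymbol\sigma=(\sigma_x)_{x\in\Omega}$ be drawn from the Ising model on $\Omega$ at inverse temperature $\beta$ with zero external field. For $k=0,1,\dots,d-1$ put $$\theta_k(\beta)=\frac1{4^d}\binom{2d}{2k+1}\sum_{\sigma\in\{-1,+1\}^{2d}}\tanh\Bigl(\beta\sum_{i=1}^{2d}\sigma_i\Bigr)\prod_{j=1}^{2k+1}\sigma_j,\qquad b(\beta)=|1-\theta_0(\beta)|+\sum_{k=1}^{d-1}(2k+1)|\theta_k(\beta)|.$$ Then for any $t\ge0$, $$\mathbb{P}\Bigl(\sqrt{|\Omega|}\,\Bigl|(1-\theta_0(\beta))m(\boldsymbol\sigma)-\sum_{k=1}^{d-1}\theta_k(\beta)r_{2k+1}(\boldsymbol\sigma)\Bigr|\ge t\Bigr)\le2\exp\Bigl(-\frac{t^2}{4b(\beta)}\Bigr).$$ Moreover, $$\theta_0(\beta)=\frac1{4^{d-1}}\sum_{k=1}^dk\binom{2d}{d+k}\tanh(2k\beta),$$ and for $d\ge2$ there exists $\beta_1\in(0,\infty)$, depending on $d$, such that $1-\theta_0(\beta)>0$ for $\beta<\beta_1$ and $1-\theta_0(\beta)<0$ for $\beta>\beta_1$.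
   Context: $\Omega$ is the graph obtained from the box $\{1,2,\dots,n+1\}^d\subset\mathbb{Z}^d$ by identifying opposite boundary points: $x$ and $y$ are identified if $x_i-y_i\in\{-n,0,n\}$ for all $i$ (periodic boundary condition), so $|\Omega|=n^d$. Write $x\sim y$ if $x,y\in\Omega$ are nearest neighbors in $\Omega$, and $N_x=\{y\in\Omega:y\sim x\}$ for the set of nearest neighbors of $x$. The Ising model at inverse temperature $\beta$ with zero external field is the probability measure on $\{+1,-1\}^\Omega$ with $\mathbb{P}(\boldsymbol\sigma)\propto\exp\bigl(\beta\sum_{x\sim y}\sigma_x\sigma_y\bigr)$, each nearest-neighbor pair being counted once. The magnetization is $m(\boldsymbol\sigma)=\frac1{|\Omega|}\sum_{x\in\Omega}\sigma_x$, and for $1\le k\le 2d$, $$r_k(\boldsymbol\sigma)=\Bigl(\binom{2d}{k}|\Omega|\Bigr)^{-1}\sum_{x\in\Omega}\ \sum_{S\subseteq N_x,\,|S|=k}\ \prod_{y\in S}\sigma_y .$$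
   Formalization: For n=2 the two opposite directions along an axis lead to the same vertex; they are counted as two neighbours and two parallel edges, so each vertex has degree 2d. With N_x a bare set and each pair counted once, the bound fails for n=2 and large d (e.g. d=40, β large). *)

theory Defs
  imports "HOL-Probability.Probability_Mass_Function"
begin

text \<open>
  The torus is obtained from the box \<open>{1..n+1}\<^sup>d\<close> by gluing opposite boundary points.
  Every class of glued points has exactly one representative in \<open>{1..n}\<^sup>d\<close>
  (lemma \<open>torus_representative\<close>), and these representatives serve as the vertices.
\<close>

definition box :: "nat \<Rightarrow> nat \<Rightarrow> (nat \<Rightarrow> int) set" where
  "box d n = {1..d} \<rightarrow>\<^sub>E {1..int n + 1}"

definition glued :: "nat \<Rightarrow> nat \<Rightarrow> (nat \<Rightarrow> int) \<Rightarrow> (nat \<Rightarrow> int) \<Rightarrow> bool" where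
  "glued d n x y \<longleftrightarrow> (\<forall>i\<in>{1..d}. x i - y i \<in> {- int n, 0, int n})"

definition torus :: "nat \<Rightarrow> nat \<Rightarrow> (nat \<Rightarrow> int) set" where
  "torus d n = {1..d} \<rightarrow>\<^sub>E {1..int n}"

text \<open>
  A direction \<open>(i, s)\<close> stands for the unit vector \<open>s e\<^sub>i\<close>, and \<open>step n x (i, s)\<close> is the
  neighbour of \<open>x\<close> in that direction, with the \<open>i\<close>-th coordinate reduced modulo \<open>n\<close> to
  \<open>{1..n}\<close>. Neighbours are indexed by their direction. For \<open>n \<ge> 3\<close> the \<open>2d\<close> neighbours of a
  vertex are distinct, so this is the same as working with the set of nearest neighbours
  (lemmas \<open>bij_betw_step\<close>, \<open>nbr_corr_neighbours\<close>, \<open>energy_edges\<close>). For \<open>n = 2\<close> the two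
  neighbours in the directions \<open>e\<^sub>i\<close> and \<open>-e\<^sub>i\<close> coincide: gluing the path with vertices
  \<open>1, 2, 3\<close> at its ends gives a pair of parallel edges, and indexing by directions retains
  both of them, so that every vertex has degree \<open>2d\<close>, as the normalisation by
  \<open>2d choose k\<close> in \<open>nbr_corr\<close> requires.
\<close>

definition dirs :: "nat \<Rightarrow> (nat \<times> int) set" where
  "dirs d = {1..d} \<times> {-1, 1}"

definition step :: "nat \<Rightarrow> (nat \<Rightarrow> int) \<Rightarrow> nat \<times> int \<Rightarrow> (nat \<Rightarrow> int)" where
  "step n x e = x(fst e := (x (fst e) + snd e - 1) mod int n + 1)"

definition configs :: "nat \<Rightarrow> nat \<Rightarrow> ((nat \<Rightarrow> int) \<Rightarrow> real) set" where
  "configs d n = torus d n \<rightarrow>\<^sub>E {-1, 1}"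

text \<open>Summing over the positive directions only counts each edge of the torus once.\<close>

definition energy :: "nat \<Rightarrow> nat \<Rightarrow> ((nat \<Rightarrow> int) \<Rightarrow> real) \<Rightarrow> real" where
  "energy d n \<sigma> = (\<Sum>x\<in>torus d n. \<Sum>i=1..d. \<sigma> x * \<sigma> (step n x (i, 1)))"

definition partition_function :: "nat \<Rightarrow> nat \<Rightarrow> real \<Rightarrow> real" where
  "partition_function d n \<beta> = (\<Sum>\<sigma>\<in>configs d n. exp (\<beta> * energy d n \<sigma>))"

definition ising :: "nat \<Rightarrow> nat \<Rightarrow> real \<Rightarrow> ((nat \<Rightarrow> int) \<Rightarrow> real) pmf" where
  "ising d n \<beta> = embed_pmf (\<lambda>\<sigma>. if \<sigma> \<in> configs d n
     then exp (\<beta> * energy d n \<sigma>) / partition_function d n \<beta> else 0)"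

definition magnetization :: "nat \<Rightarrow> nat \<Rightarrow> ((nat \<Rightarrow> int) \<Rightarrow> real) \<Rightarrow> real" where
  "magnetization d n \<sigma> = (1 / real (card (torus d n))) * (\<Sum>x\<in>torus d n. \<sigma> x)"

definition nbr_corr :: "nat \<Rightarrow> nat \<Rightarrow> nat \<Rightarrow> ((nat \<Rightarrow> int) \<Rightarrow> real) \<Rightarrow> real" where
  "nbr_corr d n k \<sigma> =
     inverse (real ((2 * d) choose k) * real (card (torus d n))) *
     (\<Sum>x\<in>torus d n. \<Sum>S | S \<subseteq> dirs d \<and> card S = k. \<Prod>e\<in>S. \<sigma> (step n x e))"

definition theta :: "nat \<Rightarrow> nat \<Rightarrow> real \<Rightarrow> real" where
  "theta d k \<beta> = (1 / 4 ^ d) * real ((2 * d) choose (2 * k + 1)) *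
     (\<Sum>s\<in>{1..2 * d} \<rightarrow>\<^sub>E {-1, 1 :: real}.
        tanh (\<beta> * (\<Sum>i=1..2 * d. s i)) * (\<Prod>j=1..2 * k + 1. s j))"

definition bcoeff :: "nat \<Rightarrow> real \<Rightarrow> real" where
  "bcoeff d \<beta> = \<bar>1 - theta d 0 \<beta>\<bar> + (\<Sum>k=1..d - 1. real (2 * k + 1) * \<bar>theta d k \<beta>\<bar>)"

text \<open>
  Adjacency of torus vertices as read off from the glued box: some glued copies of the two
  vertices are at distance 1 in \<open>\<int>\<^sup>d\<close>.
\<close>

definition box_adj :: "nat \<Rightarrow> (nat \<Rightarrow> int) \<Rightarrow> (nat \<Rightarrow> int) \<Rightarrow> bool" where
  "box_adj d x y \<longleftrightarrow> (\<Sum>i=1..d. \<bar>x i - y i\<bar>) = 1"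

definition torus_adj :: "nat \<Rightarrow> nat \<Rightarrow> (nat \<Rightarrow> int) \<Rightarrow> (nat \<Rightarrow> int) \<Rightarrow> bool" where
  "torus_adj d n x y \<longleftrightarrow>
     (\<exists>x'\<in>box d n. \<exists>y'\<in>box d n. glued d n x x' \<and> glued d n y y' \<and> box_adj d x' y')"

definition neighbours :: "nat \<Rightarrow> nat \<Rightarrow> (nat \<Rightarrow> int) \<Rightarrow> (nat \<Rightarrow> int) set" where
  "neighbours d n x = {y \<in> torus d n. torus_adj d n x y}"

lemma finite_torus [simp]: "finite (torus d n)"
  by (simp add: torus_def finite_PiE)

lemma card_torus: "card (torus d n) = n ^ d"
  by (simp add: torus_def card_PiE)

lemma torus_subset_box: "torus d n \<subseteq> box d n"
  unfolding torus_def box_def by (rule PiE_mono) auto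

lemma finite_dirs [simp]: "finite (dirs d)"
  by (simp add: dirs_def)

lemma card_dirs: "card (dirs d) = 2 * d"
  by (simp add: dirs_def card_cartesian_product)

lemma finite_configs [simp]: "finite (configs d n)"
  by (simp add: configs_def finite_PiE)

lemma torus_representative:
  assumes "n \<ge> 1" and x: "x \<in> box d n"
  shows "\<exists>!y. y \<in> torus d n \<and> glued d n x y"
proof (rule ex1I)
  let ?y = "\<lambda>i. if i \<in> {1..d} then (if x i = int n + 1 then 1 else x i) else undefined"
  have xi: "x i \<in> {1..int n + 1}" if "i \<in> {1..d}" for i
    using x that by (auto simp: box_def)
  show "?y \<in> torus d n \<and> glued d n x ?y"
    using xi assms(1) by (force simp: torus_def glued_def PiE_def extensional_def)
  fix y assume y: "y \<in> torus d n \<and> glued d n x y"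
  show "y = ?y"
  proof
    fix i show "y i = ?y i"
    proof (cases "i \<in> {1..d}")
      case True
      then have "y i \<in> {1..int n}" "x i - y i \<in> {- int n, 0, int n}"
        using y by (auto simp: torus_def glued_def)
      then show ?thesis using xi[OF True] True by auto
    next
      case False
      then show ?thesis using y by (auto simp: torus_def PiE_def extensional_def)
    qed
  qed
qed

lemma step_in_torus:
  assumes "n \<ge> 1" "x \<in> torus d n" "e \<in> dirs d"
  shows "step n x e \<in> torus d n"
proof -
  have "(x (fst e) + snd e - 1) mod int n + 1 \<in> {1..int n}"
    using assms(1) pos_mod_bound[of "int n"] pos_mod_sign[of "int n"]
    by (auto simp: add1_zle_eq)
  then show ?thesis
    using assms(2,3) by (auto simp: torus_def step_def dirs_def PiE_def extensional_def)
qed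

lemma box_adj_iff:
  "box_adj d x y \<longleftrightarrow>
     (\<exists>i\<in>{1..d}. \<bar>x i - y i\<bar> = 1 \<and> (\<forall>j\<in>{1..d} - {i}. x j = y j))"
proof
  assume a: "box_adj d x y"
  then obtain i where i: "i \<in> {1..d}" "x i \<noteq> y i"
    unfolding box_adj_def using sum.neutral[of "{1..d}" "\<lambda>i. \<bar>x i - y i\<bar>"] by fastforce
  have "(\<Sum>i=1..d. \<bar>x i - y i\<bar>) = \<bar>x i - y i\<bar> + (\<Sum>j\<in>{1..d} - {i}. \<bar>x j - y j\<bar>)"
    using i(1) by (intro sum.remove) auto
  moreover have "(\<Sum>j\<in>{1..d} - {i}. \<bar>x j - y j\<bar>) \<ge> 0"
    by (intro sum_nonneg) auto
  ultimately have "\<bar>x i - y i\<bar> = 1" "(\<Sum>j\<in>{1..d} - {i}. \<bar>x j - y j\<bar>) = 0"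
    using a i(2) unfolding box_adj_def by linarith+
  then show "\<exists>i\<in>{1..d}. \<bar>x i - y i\<bar> = 1 \<and> (\<forall>j\<in>{1..d} - {i}. x j = y j)"
    using i(1) by (intro bexI[of _ i]) (auto simp: sum_nonneg_eq_0_iff)
next
  assume "\<exists>i\<in>{1..d}. \<bar>x i - y i\<bar> = 1 \<and> (\<forall>j\<in>{1..d} - {i}. x j = y j)"
  then obtain i where i: "i \<in> {1..d}" "\<bar>x i - y i\<bar> = 1" "\<forall>j\<in>{1..d} - {i}. x j = y j"
    by blast
  have "(\<Sum>i=1..d. \<bar>x i - y i\<bar>) = \<bar>x i - y i\<bar> + (\<Sum>j\<in>{1..d} - {i}. \<bar>x j - y j\<bar>)"
    using i(1) by (intro sum.remove) auto
  also have "(\<Sum>j\<in>{1..d} - {i}. \<bar>x j - y j\<bar>) = 0"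
    using i(3) by (intro sum.neutral) auto
  finally show "box_adj d x y" using i(2) by (simp add: box_adj_def)
qed

lemma coord_step:
  fixes a :: int
  assumes "n \<ge> 2" "a \<in> {1..int n}"
  shows "(a + 1 - 1) mod int n + 1 = (if a = int n then 1 else a + 1)"
    and "(a + -1 - 1) mod int n + 1 = (if a = 1 then int n else a - 1)"
proof -
  show "(a + 1 - 1) mod int n + 1 = (if a = int n then 1 else a + 1)"
    using assms by auto
  show "(a + -1 - 1) mod int n + 1 = (if a = 1 then int n else a - 1)"
  proof (cases "a = 1")
    case True
    then show ?thesis using assms(1) by (simp add: zmod_minus1)
  next
    case False
    then show ?thesis using assms by auto
  qed
qed

lemma neighbours_eq_step_image:
  assumes n: "n \<ge> 2" and x: "x \<in> torus d n"
  shows "neighbours d n x = step n x ` dirs d"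
proof (intro equalityI subsetI)
  fix y assume "y \<in> neighbours d n x"
  then obtain x' y' where y: "y \<in> torus d n" and x': "x' \<in> box d n" and y': "y' \<in> box d n"
    and g: "glued d n x x'" "glued d n y y'" and adj: "box_adj d x' y'"
    by (auto simp: neighbours_def torus_adj_def)
  from adj obtain i where i: "i \<in> {1..d}" "\<bar>x' i - y' i\<bar> = 1"
    and j: "\<And>j. j \<in> {1..d} - {i} \<Longrightarrow> x' j = y' j"
    by (auto simp: box_adj_iff)
  have R: "x j \<in> {1..int n}" "y j \<in> {1..int n}" "x' j \<in> {1..int n + 1}"
    "y' j \<in> {1..int n + 1}" "x j - x' j \<in> {- int n, 0, int n}"
    "y j - y' j \<in> {- int n, 0, int n}" if "j \<in> {1..d}" for j
    using that x y x' y' g by (auto simp: torus_def box_def glued_def)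
  have eq: "y j = x j" if "j \<noteq> i" for j
  proof (cases "j \<in> {1..d}")
    case True
    then show ?thesis using R[OF True] j[of j] that by auto
  next
    case False
    then show ?thesis using x y by (auto simp: torus_def PiE_def extensional_def)
  qed
  have "\<exists>s\<in>{-1,1}. y i = (x i + s - 1) mod int n + 1"
    using R[OF i(1)] i(2) coord_step[OF n R(1)[OF i(1)]] n
    by (auto split: if_splits)
  then obtain s where s: "s \<in> {-1,1}" "y i = (x i + s - 1) mod int n + 1" by blast
  have "y = step n x (i, s)"
    using s(2) eq by (auto simp: step_def fun_eq_iff)
  then show "y \<in> step n x ` dirs d"
    using i(1) s(1) by (auto simp: dirs_def)
next
  fix y assume "y \<in> step n x ` dirs d"
  then obtain i s where i: "i \<in> {1..d}" and s: "s = -1 \<or> s = 1" and y: "y = step n x (i, s)"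
    unfolding dirs_def by blast
  have yt: "y \<in> torus d n"
    using n x i s unfolding y by (intro step_in_torus) (auto simp: dirs_def)
  have xi: "x i \<in> {1..int n}" using x i by (auto simp: torus_def)
  have yi: "y i = (x i + s - 1) mod int n + 1" by (simp add: y step_def)
  define a b where "a = (if s = -1 \<and> x i = 1 then int n + 1 else x i)"
    and "b = (if s = 1 \<and> x i = int n then int n + 1 else y i)"
  have ab: "a \<in> {1..int n + 1}" "b \<in> {1..int n + 1}" "x i - a \<in> {- int n, 0, int n}"
    "y i - b \<in> {- int n, 0, int n}" "\<bar>a - b\<bar> = 1"
    using xi yi s n coord_step[OF n xi] unfolding a_def b_def by (auto split: if_splits)
  have sub: "x \<in> box d n" "y \<in> box d n" using x yt torus_subset_box by auto
  have "x(i := a) \<in> box d n" "y(i := b) \<in> box d n"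
    using sub ab i by (auto simp: box_def PiE_def extensional_def)
  moreover have "glued d n x (x(i := a))" "glued d n y (y(i := b))"
    using ab by (auto simp: glued_def)
  moreover have "box_adj d (x(i := a)) (y(i := b))"
    using i ab by (auto simp: box_adj_iff y step_def intro!: bexI[of _ i])
  ultimately show "y \<in> neighbours d n x"
    using yt unfolding neighbours_def torus_adj_def by blast
qed

lemma inj_on_step:
  assumes n: "n \<ge> 3" and x: "x \<in> torus d n"
  shows "inj_on (step n x) (dirs d)"
proof (rule inj_onI, clarify)
  fix i s j t assume a: "(i, s) \<in> dirs d" "(j, t) \<in> dirs d" "step n x (i, s) = step n x (j, t)"
  have i: "x i \<in> {1..int n}" and j: "x j \<in> {1..int n}"
    using a x by (auto simp: dirs_def torus_def)
  have "step n x (i, s) i = step n x (j, t) i" using a(3) by simp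
  then show "i = j \<and> s = t"
    using a(1,2) n coord_step[OF _ i] by (auto simp: dirs_def step_def split: if_splits)
qed

lemma bij_betw_step:
  assumes "n \<ge> 3" "x \<in> torus d n"
  shows "bij_betw (step n x) (dirs d) (neighbours d n x)"
  using assms inj_on_step neighbours_eq_step_image[of n x d] by (simp add: bij_betw_def)

lemma nbr_corr_neighbours:
  assumes "n \<ge> 3"
  shows "nbr_corr d n k \<sigma> =
    inverse (real ((2 * d) choose k) * real (card (torus d n))) *
    (\<Sum>x\<in>torus d n. \<Sum>S | S \<subseteq> neighbours d n x \<and> card S = k. \<Prod>y\<in>S. \<sigma> y)"
proof -
  have "(\<Sum>S | S \<subseteq> dirs d \<and> card S = k. \<Prod>e\<in>S. \<sigma> (step n x e)) =
      (\<Sum>S | S \<subseteq> neighbours d n x \<and> card S = k. \<Prod>y\<in>S. \<sigma> y)"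
    if x: "x \<in> torus d n" for x
  proof -
    note b = bij_betw_step[OF assms x]
    have inj: "inj_on (step n x) S" if "S \<subseteq> dirs d" for S
      using b that by (auto simp: bij_betw_def intro: inj_on_subset)
    have "bij_betw (image (step n x)) {S. S \<subseteq> dirs d \<and> card S = k}
        {S. S \<subseteq> neighbours d n x \<and> card S = k}"
      using bij_betw_Collect[OF bij_betw_Pow[OF b], of "\<lambda>S. card S = k" "\<lambda>S. card S = k"] inj
      by (simp add: card_image)
    then have "(\<Sum>S | S \<subseteq> neighbours d n x \<and> card S = k. \<Prod>y\<in>S. \<sigma> y) =
        (\<Sum>S | S \<subseteq> dirs d \<and> card S = k. \<Prod>y\<in>step n x ` S. \<sigma> y)"
      by (simp add: sum.reindex_bij_betw[symmetric])
    also have "\<dots> = (\<Sum>S | S \<subseteq> dirs d \<and> card S = k. \<Prod>e\<in>S. \<sigma> (step n x e))"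
      using inj by (intro sum.cong) (auto simp: prod.reindex)
    finally show ?thesis by simp
  qed
  then show ?thesis by (simp add: nbr_corr_def)
qed

lemma step_inverse:
  assumes "n \<ge> 2" "x \<in> torus d n" "i \<in> {1..d}"
  shows "step n (step n x (i, -1)) (i, 1) = x"
proof -
  have "x i \<in> {1..int n}" using assms by (auto simp: torus_def)
  then show ?thesis
    using assms(1) coord_step[OF assms(1), of "x i"]
    by (auto simp: step_def fun_eq_iff)
qed

lemma energy_edges:
  assumes n: "n \<ge> 3"
  shows "energy d n \<sigma> =
    (\<Sum>e\<in>{{x, y} | x y. x \<in> torus d n \<and> y \<in> neighbours d n x}. \<Prod>z\<in>e. \<sigma> z)"
proof -
  let ?E = "{{x, y} | x y. x \<in> torus d n \<and> y \<in> neighbours d n x}"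
  let ?h = "\<lambda>(x, i). {x, step n x (i, 1)}"
  have n2: "n \<ge> 2" using n by simp
  have coord: "step n x (i, 1) i = (if x i = int n then 1 else x i + 1)"
    if "x \<in> torus d n" "i \<in> {1..d}" for x i
  proof -
    have "x i \<in> {1..int n}" using that by (auto simp: torus_def)
    from coord_step(1)[OF n2 this] show ?thesis by (auto simp: step_def)
  qed
  have other: "step n x (i, 1) j = x j" if "j \<noteq> i" for x i j
    using that by (simp add: step_def)
  have ne: "step n x (i, 1) i \<noteq> x i" if "x \<in> torus d n" "i \<in> {1..d}" for x i
    using coord[OF that] n by (auto split: if_splits)
  have inj: "inj_on ?h (torus d n \<times> {1..d})"
  proof (rule inj_onI, clarify)
    fix x i y j
    assume x: "x \<in> torus d n" and i: "i \<in> {1..d}" and y: "y \<in> torus d n" and j: "j \<in> {1..d}"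
      and eq: "{x, step n x (i, 1)} = {y, step n y (j, 1)}"
    have eq': "x = y \<and> step n x (i, 1) = step n y (j, 1) \<or>
        x = step n y (j, 1) \<and> y = step n x (i, 1)"
      using eq by (auto simp: doubleton_eq_iff)
    then show "x = y \<and> i = j"
    proof
      assume a: "x = y \<and> step n x (i, 1) = step n y (j, 1)"
      then have "i = j" using ne[OF x i] other[of i j x] by metis
      with a show ?thesis by blast
    next
      assume a: "x = step n y (j, 1) \<and> y = step n x (i, 1)"
      then have "i = j" using ne[OF x i] other[of i j y] by metis
      have "x i = (if y i = int n then 1 else y i + 1)"
        using a \<open>i = j\<close> coord[OF y i] by metis
      moreover have "y i = (if x i = int n then 1 else x i + 1)"
        using a coord[OF x i] by metis
      moreover have False
        if "p = (if q = int n then 1 else q + 1)" "q = (if p = int n then 1 else p + 1)" for p q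
        using that n by presburger
      ultimately show ?thesis by blast
    qed
  qed
  have img: "?h ` (torus d n \<times> {1..d}) = ?E"
  proof (intro equalityI subsetI)
    fix e assume "e \<in> ?h ` (torus d n \<times> {1..d})"
    then obtain x i where "x \<in> torus d n" "i \<in> {1..d}" "e = {x, step n x (i, 1)}" by auto
    moreover from this have "step n x (i, 1) \<in> neighbours d n x"
      using neighbours_eq_step_image[OF n2, of x d] by (auto simp: dirs_def)
    ultimately show "e \<in> ?E" by blast
  next
    fix e assume "e \<in> ?E"
    then obtain x y where x: "x \<in> torus d n" and y: "y \<in> neighbours d n x" and e: "e = {x, y}"
      by blast
    from y obtain i s where i: "i \<in> {1..d}" and s: "s = -1 \<or> s = 1" and y': "y = step n x (i, s)"
      using neighbours_eq_step_image[OF n2 x] unfolding dirs_def by blast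
    from s show "e \<in> ?h ` (torus d n \<times> {1..d})"
    proof
      assume "s = 1"
      then show ?thesis using x i e y' by (intro image_eqI[of _ _ "(x, i)"]) auto
    next
      assume "s = -1"
      then have "x = step n y (i, 1)" using step_inverse[OF n2 x i] y' by simp
      moreover have "y \<in> torus d n" using y by (simp add: neighbours_def)
      ultimately show ?thesis
        using i e by (intro image_eqI[of _ _ "(y, i)"]) auto
    qed
  qed
  have "energy d n \<sigma> =
      (\<Sum>p\<in>torus d n \<times> {1..d}. \<sigma> (fst p) * \<sigma> (step n (fst p) (snd p, 1)))"
    by (simp add: energy_def sum.cartesian_product case_prod_unfold)
  also have "\<dots> = (\<Sum>p\<in>torus d n \<times> {1..d}. \<Prod>z\<in>?h p. \<sigma> z)"
  proof (rule sum.cong)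
    fix p assume p: "p \<in> torus d n \<times> {1..d}"
    then have "step n (fst p) (snd p, 1) (snd p) \<noteq> fst p (snd p)" by (intro ne) auto
    then have "fst p \<noteq> step n (fst p) (snd p, 1)" by auto
    then show "\<sigma> (fst p) * \<sigma> (step n (fst p) (snd p, 1)) = (\<Prod>z\<in>?h p. \<sigma> z)"
      by (simp add: case_prod_unfold)
  qed simp
  also have "\<dots> = (\<Sum>e\<in>?h ` (torus d n \<times> {1..d}). \<Prod>z\<in>e. \<sigma> z)"
    using inj by (simp add: sum.reindex)
  finally show ?thesis by (simp only: img)
qed

lemma partition_function_pos: "partition_function d n \<beta> > 0"
proof -
  have "configs d n \<noteq> {}" by (auto simp: configs_def PiE_eq_empty_iff)
  then show ?thesis by (simp add: partition_function_def sum_pos)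
qed

lemma pmf_ising:
  "pmf (ising d n \<beta>) \<sigma> = (if \<sigma> \<in> configs d n
     then exp (\<beta> * energy d n \<sigma>) / partition_function d n \<beta> else 0)"
  unfolding ising_def
proof (rule pmf_embed_pmf)
  let ?f = "\<lambda>\<sigma>. if \<sigma> \<in> configs d n
     then exp (\<beta> * energy d n \<sigma>) / partition_function d n \<beta> else 0"
  show nonneg: "0 \<le> ?f \<sigma>" for \<sigma>
    using partition_function_pos[of d n \<beta>] by simp
  have "(\<integral>\<^sup>+\<sigma>. ennreal (?f \<sigma>) \<partial>count_space UNIV) = (\<Sum>\<sigma>\<in>configs d n. ennreal (?f \<sigma>))"
    by (rule nn_integral_count_space'[OF finite_configs]) auto
  also have "\<dots> = ennreal (\<Sum>\<sigma>\<in>configs d n. ?f \<sigma>)"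
    using nonneg by (rule sum_ennreal)
  also have "(\<Sum>\<sigma>\<in>configs d n. ?f \<sigma>) = 1"
    using partition_function_pos[of d n \<beta>]
    by (simp add: sum_divide_distrib[symmetric] partition_function_def)
  finally show "(\<integral>\<^sup>+\<sigma>. ennreal (?f \<sigma>) \<partial>count_space UNIV) = 1" by simp
qed

end

theory Submission
  imports Defs
begin

text \<open>
  Let \<open>\<sigma>'\<close> arise from \<open>\<sigma>\<close> by resampling the spin at a uniformly random site \<open>x\<close> from its
  conditional law, under which it has mean \<open>tanh (\<beta> h\<^sub>x)\<close>, where \<open>h\<^sub>x\<close> is the sum of the
  neighbouring spins. The pair is exchangeable, and the mean of the antisymmetric function
  \<open>\<Sum>x. \<sigma>\<^sub>x - \<sigma>'\<^sub>x\<close> given \<open>\<sigma>\<close> is \<open>f = |\<Omega>|\<inverse> \<Sum>x. (\<sigma>\<^sub>x - tanh (\<beta> h\<^sub>x))\<close>. Expanding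
  \<open>tanh\<close> of \<open>\<beta>\<close> times a sum of \<open>2d\<close> spins into Fourier-Walsh monomials, of which only those of
  odd degree survive, turns \<open>f\<close> into \<open>(1 - \<theta>\<^sub>0) m - \<Sum>k. \<theta>\<^sub>k r\<^bsub>2k+1\<^esub>\<close>. A single flip
  changes \<open>m\<close> by at most \<open>2/|\<Omega>|\<close> and \<open>r\<^sub>k\<close> by at most \<open>2k/|\<Omega>|\<close>, hence \<open>f\<close> by at most
  \<open>2b/|\<Omega>|\<close>. By exchangeability the moment generating function \<open>M\<close> of \<open>f\<close> then satisfies
  \<open>M' \<lambda> \<le> \<lambda> (2b/|\<Omega>|) M \<lambda>\<close>, which gives the Gaussian tail (Chatterjee's version of Stein's
  method).

  In the closed form, \<open>\<theta>\<^sub>0\<close> is strictly increasing, vanishes at \<open>0\<close> and tends to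
  \<open>2d (2d choose d) / 4\<^sup>d\<close>, which exceeds \<open>1\<close> exactly when \<open>d \<ge> 2\<close>.
\<close>

section \<open>Concentration by exchangeable pairs\<close>

text \<open>By convexity the integral of exp between the two points is at most the trapezoid area.
  The symmetric mean is what lets exchangeability merge the two endpoint values later.\<close>

lemma abs_exp_diff_le: "\<bar>exp x - exp y\<bar> \<le> \<bar>x - y\<bar> * ((exp x + exp y) / 2)" for x y :: real
proof -
  have base: "exp z - 1 \<le> z * ((exp z + 1) / 2)" if "z \<ge> 0" for z :: real
  proof -
    let ?g = "\<lambda>z::real. z * ((exp z + 1) / 2) - (exp z - 1)"
    have "?g 0 \<le> ?g z"
    proof (rule DERIV_nonneg_imp_nondecreasing[OF that])
      fix u :: real assume "0 \<le> u" "u \<le> z"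
      \<comment> \<open>The derivative of \<open>?g\<close> at \<open>u\<close> is
        \<open>(1 - (1 - u) * exp u) / 2\<close>, and 1 - u is at most e^(-u).\<close>
      have "(1 - u) * exp u \<le> exp (- u) * exp u"
        using exp_ge_add_one_self[of "- u"] by (intro mult_right_mono) auto
      then have "(exp u + 1) / 2 + u * (exp u / 2) - exp u \<ge> 0"
        by (simp add: exp_minus field_simps)
      moreover have "(?g has_real_derivative ((exp u + 1) / 2 + u * (exp u / 2) - exp u)) (at u)"
        by (auto intro!: derivative_eq_intros)
      ultimately show "\<exists>D. (?g has_real_derivative D) (at u) \<and> 0 \<le> D" by blast
    qed
    then show ?thesis by simp
  qed
  have le: "\<bar>exp x - exp y\<bar> \<le> \<bar>x - y\<bar> * ((exp x + exp y) / 2)" if "y \<le> x" for x y :: real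
  proof -
    have "exp y * (exp (x - y) - 1) \<le> exp y * ((x - y) * ((exp (x - y) + 1) / 2))"
      using base[of "x - y"] that by (intro mult_left_mono) auto
    moreover have "exp x = exp y * exp (x - y)"
      by (simp add: exp_diff)
    ultimately show ?thesis
      using that by (simp add: algebra_simps)
  qed
  show ?thesis
    using le[of x y] le[of y x] by (cases "y \<le> x") (auto simp: abs_minus_commute add.commute)
qed

text \<open>
  In one step of the reversible chain, \<open>\<sigma>\<close> moves to \<open>\<tau> x \<sigma>\<close> with probability \<open>p x \<sigma>\<close>
  and otherwise stays put.
\<close>

locale exchangeable_flips =
  fixes C :: "'a set" and V :: "'v set" and w :: "'a \<Rightarrow> real" and \<tau> :: "'v \<Rightarrow> 'a \<Rightarrow> 'a"
    and p F :: "'v \<Rightarrow> 'a \<Rightarrow> real" and f :: "'a \<Rightarrow> real" and v :: real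
  assumes fin: "finite C"
    and w_nonneg: "\<sigma> \<in> C \<Longrightarrow> 0 \<le> w \<sigma>" and w_sum: "sum w C = 1"
    and \<tau>_in: "x \<in> V \<Longrightarrow> \<sigma> \<in> C \<Longrightarrow> \<tau> x \<sigma> \<in> C"
    and \<tau>_\<tau>: "x \<in> V \<Longrightarrow> \<sigma> \<in> C \<Longrightarrow> \<tau> x (\<tau> x \<sigma>) = \<sigma>"
    and p_nonneg: "x \<in> V \<Longrightarrow> \<sigma> \<in> C \<Longrightarrow> 0 \<le> p x \<sigma>"
    and balance: "x \<in> V \<Longrightarrow> \<sigma> \<in> C \<Longrightarrow> w (\<tau> x \<sigma>) * p x (\<tau> x \<sigma>) = w \<sigma> * p x \<sigma>"
    and antisym: "x \<in> V \<Longrightarrow> \<sigma> \<in> C \<Longrightarrow> F x (\<tau> x \<sigma>) = - F x \<sigma>"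
    and drift: "\<sigma> \<in> C \<Longrightarrow> (\<Sum>x\<in>V. p x \<sigma> * F x \<sigma>) = f \<sigma>"
    and variance: "\<sigma> \<in> C \<Longrightarrow> (\<Sum>x\<in>V. p x \<sigma> * \<bar>F x \<sigma>\<bar> * \<bar>f \<sigma> - f (\<tau> x \<sigma>)\<bar>) \<le> 2 * v"
begin

text \<open>Symmetry under a change of sign, by which the lower tail follows from the upper
  one.\<close>

lemma uminus: "exchangeable_flips C V w \<tau> p (\<lambda>x \<sigma>. - F x \<sigma>) (\<lambda>\<sigma>. - f \<sigma>) v"
  using fin w_nonneg w_sum \<tau>_in \<tau>_\<tau> p_nonneg balance antisym variance
  by unfold_locales (auto simp: drift[symmetric] sum_negf abs_minus_commute)

lemma sum_flip: "x \<in> V \<Longrightarrow> (\<Sum>\<sigma>\<in>C. g (\<tau> x \<sigma>)) = (\<Sum>\<sigma>\<in>C. g \<sigma>)"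
  by (rule sum.reindex_bij_witness[of _ "\<tau> x" "\<tau> x"]) (auto simp: \<tau>_in \<tau>_\<tau>)

text \<open>The left side is the derivative of the moment generating function at \<open>l\<close>.
  \<open>drift\<close> replaces f by the mean of F, exchangeability antisymmetrises the exponential
  and yields a factor 1/2, and \<open>abs_exp_diff_le\<close> brings out \<open>l\<close>; what is
  left is half the sum bounded in \<open>variance\<close>.\<close>

lemma mgf_deriv_le:
  assumes "l \<ge> 0"
  shows "(\<Sum>\<sigma>\<in>C. w \<sigma> * (f \<sigma> * exp (l * f \<sigma>))) \<le> l * v * (\<Sum>\<sigma>\<in>C. w \<sigma> * exp (l * f \<sigma>))"
proof -
  let ?e = "\<lambda>\<sigma>. exp (l * f \<sigma>)"
  have site: "(\<Sum>\<sigma>\<in>C. w \<sigma> * p x \<sigma> * F x \<sigma> * ?e \<sigma>)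
      \<le> (\<Sum>\<sigma>\<in>C. w \<sigma> * p x \<sigma> * \<bar>F x \<sigma>\<bar> * (l / 2 * \<bar>f \<sigma> - f (\<tau> x \<sigma>)\<bar>) * ?e \<sigma>)"
    (is "?L \<le> ?R") if x: "x \<in> V" for x
  proof -
    let ?c = "\<lambda>\<sigma>. w \<sigma> * p x \<sigma>"
    let ?D = "\<lambda>\<sigma>. \<bar>f \<sigma> - f (\<tau> x \<sigma>)\<bar>"
    have "?L = (\<Sum>\<sigma>\<in>C. ?c (\<tau> x \<sigma>) * F x (\<tau> x \<sigma>) * ?e (\<tau> x \<sigma>))"
      by (rule sum_flip[OF x, symmetric])
    \<comment> \<open>Detailed balance fixes \<open>?c\<close> under the flip and \<open>F x\<close>
      changes sign, so \<open>?L\<close> is also the average of itself and this sum.\<close>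
    also have "\<dots> = (\<Sum>\<sigma>\<in>C. - (?c \<sigma> * F x \<sigma> * ?e (\<tau> x \<sigma>)))"
      using x by (intro sum.cong) (auto simp: balance antisym)
    finally have "2 * ?L = (\<Sum>\<sigma>\<in>C. ?c \<sigma> * F x \<sigma> * (?e \<sigma> - ?e (\<tau> x \<sigma>)))"
      by (simp add: sum_negf sum_subtractf algebra_simps)
    also have "\<dots> \<le> (\<Sum>\<sigma>\<in>C. ?c \<sigma> * (\<bar>F x \<sigma>\<bar> * (l * ?D \<sigma> * ((?e \<sigma> + ?e (\<tau> x \<sigma>)) / 2))))"
    proof (rule sum_mono)
      fix \<sigma> assume s: "\<sigma> \<in> C"
      have "\<bar>?e \<sigma> - ?e (\<tau> x \<sigma>)\<bar> \<le> l * ?D \<sigma> * ((?e \<sigma> + ?e (\<tau> x \<sigma>)) / 2)"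
        using abs_exp_diff_le[of "l * f \<sigma>" "l * f (\<tau> x \<sigma>)"] assms
        by (simp add: right_diff_distrib[symmetric] abs_mult)
      then have "F x \<sigma> * (?e \<sigma> - ?e (\<tau> x \<sigma>)) \<le> \<bar>F x \<sigma>\<bar> * (l * ?D \<sigma> * ((?e \<sigma> + ?e (\<tau> x \<sigma>)) / 2))"
        using abs_ge_self[of "F x \<sigma> * (?e \<sigma> - ?e (\<tau> x \<sigma>))"]
          mult_left_mono[of "\<bar>?e \<sigma> - ?e (\<tau> x \<sigma>)\<bar>" _ "\<bar>F x \<sigma>\<bar>"]
        unfolding abs_mult by (meson abs_ge_zero order.trans)
      then show "?c \<sigma> * F x \<sigma> * (?e \<sigma> - ?e (\<tau> x \<sigma>)) \<le>
          ?c \<sigma> * (\<bar>F x \<sigma>\<bar> * (l * ?D \<sigma> * ((?e \<sigma> + ?e (\<tau> x \<sigma>)) / 2)))"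
        unfolding mult.assoc[of "?c \<sigma>"]
        using w_nonneg[OF s] p_nonneg[OF x s] by (intro mult_left_mono) auto
    qed
    also have "\<dots> = (\<Sum>\<sigma>\<in>C. ?c \<sigma> * \<bar>F x \<sigma>\<bar> * (l / 2 * ?D \<sigma>) * ?e \<sigma>)
        + (\<Sum>\<sigma>\<in>C. ?c \<sigma> * \<bar>F x \<sigma>\<bar> * (l / 2 * ?D \<sigma>) * ?e (\<tau> x \<sigma>))"
      by (simp add: sum.distrib[symmetric] algebra_simps add_divide_distrib)
    \<comment> \<open>All factors except the exponential are invariant under the flip, so the second
      endpoint contributes as much as the first.\<close>
    also have "(\<Sum>\<sigma>\<in>C. ?c \<sigma> * \<bar>F x \<sigma>\<bar> * (l / 2 * ?D \<sigma>) * ?e (\<tau> x \<sigma>)) =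
        (\<Sum>\<sigma>\<in>C. ?c (\<tau> x \<sigma>) * \<bar>F x (\<tau> x \<sigma>)\<bar> * (l / 2 * ?D (\<tau> x \<sigma>)) * ?e (\<tau> x \<sigma>))"
      using x by (intro sum.cong) (auto simp: balance antisym \<tau>_\<tau> abs_minus_commute)
    also have "\<dots> = ?R"
      by (rule sum_flip[OF x])
    finally show ?thesis by simp
  qed
  have "(\<Sum>\<sigma>\<in>C. w \<sigma> * (f \<sigma> * ?e \<sigma>))
      = (\<Sum>\<sigma>\<in>C. w \<sigma> * ((\<Sum>x\<in>V. p x \<sigma> * F x \<sigma>) * ?e \<sigma>))"
    by (intro sum.cong) (auto simp: drift)
  also have "\<dots> = (\<Sum>\<sigma>\<in>C. \<Sum>x\<in>V. w \<sigma> * p x \<sigma> * F x \<sigma> * ?e \<sigma>)"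
    by (simp add: sum_distrib_left sum_distrib_right mult_ac)
  also have "\<dots> = (\<Sum>x\<in>V. \<Sum>\<sigma>\<in>C. w \<sigma> * p x \<sigma> * F x \<sigma> * ?e \<sigma>)"
    by (rule sum.swap)
  also have "\<dots> \<le> (\<Sum>x\<in>V. \<Sum>\<sigma>\<in>C. w \<sigma> * p x \<sigma> * \<bar>F x \<sigma>\<bar> * (l / 2 * \<bar>f \<sigma> - f (\<tau> x \<sigma>)\<bar>) * ?e \<sigma>)"
    by (intro sum_mono site)
  also have "\<dots> = (\<Sum>\<sigma>\<in>C. \<Sum>x\<in>V. w \<sigma> * p x \<sigma> * \<bar>F x \<sigma>\<bar> * (l / 2 * \<bar>f \<sigma> - f (\<tau> x \<sigma>)\<bar>) * ?e \<sigma>)"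
    by (rule sum.swap)
  also have "\<dots> = (\<Sum>\<sigma>\<in>C. w \<sigma> * ?e \<sigma> * (l / 2) * (\<Sum>x\<in>V. p x \<sigma> * \<bar>F x \<sigma>\<bar> * \<bar>f \<sigma> - f (\<tau> x \<sigma>)\<bar>))"
    by (simp add: sum_distrib_left mult_ac)
  also have "\<dots> \<le> (\<Sum>\<sigma>\<in>C. w \<sigma> * ?e \<sigma> * (l / 2) * (2 * v))"
    using assms by (intro sum_mono mult_left_mono variance) (auto simp: w_nonneg)
  also have "\<dots> = l * v * (\<Sum>\<sigma>\<in>C. w \<sigma> * ?e \<sigma>)"
    by (simp add: sum_distrib_left mult_ac)
  finally show ?thesis .
qed

text \<open>Integrates the differential inequality of \<open>mgf_deriv_le\<close>: its integrating
  factor makes \<open>?G\<close> nonincreasing on nonnegative arguments, and \<open>?G\<close> is 1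
  at 0.\<close>

lemma mgf_le:
  assumes "l \<ge> 0"
  shows "(\<Sum>\<sigma>\<in>C. w \<sigma> * exp (l * f \<sigma>)) \<le> exp (v * l\<^sup>2 / 2)"
proof -
  let ?M = "\<lambda>l. \<Sum>\<sigma>\<in>C. w \<sigma> * exp (l * f \<sigma>)"
  let ?G = "\<lambda>l. ?M l * exp (- (v * l\<^sup>2 / 2))"
  have "?G l \<le> ?G 0"
  proof (rule DERIV_nonpos_imp_nonincreasing[OF assms])
    fix k :: real assume k: "0 \<le> k" "k \<le> l"
    let ?M' = "\<Sum>\<sigma>\<in>C. w \<sigma> * (f \<sigma> * exp (k * f \<sigma>))"
    have "(?G has_real_derivative (?M' - k * v * ?M k) * exp (- (v * k\<^sup>2 / 2))) (at k)"
      by (auto intro!: derivative_eq_intros simp: sum_distrib_left sum_distrib_right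
          sum.distrib[symmetric] sum_negf[symmetric] algebra_simps)
    moreover have "(?M' - k * v * ?M k) * exp (- (v * k\<^sup>2 / 2)) \<le> 0"
      using mgf_deriv_le[OF k(1)] by (intro mult_nonpos_nonneg) auto
    ultimately show "\<exists>D. (?G has_real_derivative D) (at k) \<and> D \<le> 0" by blast
  qed
  then have "?G l * exp (v * l\<^sup>2 / 2) \<le> 1 * exp (v * l\<^sup>2 / 2)"
    by (intro mult_right_mono) (auto simp: w_sum)
  then show ?thesis by (simp add: mult.assoc exp_add[symmetric])
qed

lemma tail_le:
  assumes "s \<ge> 0" "v > 0"
  shows "(\<Sum>\<sigma> | \<sigma> \<in> C \<and> s \<le> f \<sigma>. w \<sigma>) \<le> exp (- (s\<^sup>2 / (2 * v)))"
proof -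
  \<comment> \<open>This choice minimises the Chernoff exponent
    \<open>v * l\<^sup>2 / 2 - l * s\<close>.\<close>
  let ?l = "s / v"
  have l: "?l \<ge> 0" using assms by simp
  have "(\<Sum>\<sigma> | \<sigma> \<in> C \<and> s \<le> f \<sigma>. w \<sigma>) \<le> (\<Sum>\<sigma> | \<sigma> \<in> C \<and> s \<le> f \<sigma>. w \<sigma> * exp (?l * (f \<sigma> - s)))"
  proof (rule sum_mono)
    fix \<sigma> assume "\<sigma> \<in> {\<sigma>. \<sigma> \<in> C \<and> s \<le> f \<sigma>}"
    then have s: "\<sigma> \<in> C" "s \<le> f \<sigma>" by auto
    then have "1 \<le> exp (?l * (f \<sigma> - s))"
      unfolding one_le_exp_iff using l by (intro mult_nonneg_nonneg) auto
    then show "w \<sigma> \<le> w \<sigma> * exp (?l * (f \<sigma> - s))"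
      using w_nonneg[OF s(1)] by (simp add: mult_le_cancel_left1)
  qed
  also have "\<dots> \<le> (\<Sum>\<sigma>\<in>C. w \<sigma> * exp (?l * (f \<sigma> - s)))"
    by (intro sum_mono2 fin) (auto simp: w_nonneg)
  also have "\<dots> = exp (- (?l * s)) * (\<Sum>\<sigma>\<in>C. w \<sigma> * exp (?l * f \<sigma>))"
    by (simp add: sum_distrib_left exp_diff exp_minus algebra_simps divide_inverse del: times_divide_eq_left)
  also have "\<dots> \<le> exp (- (?l * s)) * exp (v * ?l\<^sup>2 / 2)"
    by (intro mult_left_mono mgf_le l) auto
  also have "\<dots> = exp (- (s\<^sup>2 / (2 * v)))"
    using assms(2) by (simp add: exp_add[symmetric] field_simps power2_eq_square)
  finally show ?thesis .
qed

lemma two_sided_tail_le: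
  assumes "s \<ge> 0" "v > 0"
  shows "(\<Sum>\<sigma> | \<sigma> \<in> C \<and> s \<le> \<bar>f \<sigma>\<bar>. w \<sigma>) \<le> 2 * exp (- (s\<^sup>2 / (2 * v)))"
proof -
  have "(\<Sum>\<sigma> | \<sigma> \<in> C \<and> s \<le> \<bar>f \<sigma>\<bar>. w \<sigma>)
      = sum w ({\<sigma>. \<sigma> \<in> C \<and> s \<le> f \<sigma>} \<union> {\<sigma>. \<sigma> \<in> C \<and> s \<le> - f \<sigma>})"
    by (rule sum.cong) auto
  also have "\<dots> \<le> (\<Sum>\<sigma> | \<sigma> \<in> C \<and> s \<le> f \<sigma>. w \<sigma>) + (\<Sum>\<sigma> | \<sigma> \<in> C \<and> s \<le> - f \<sigma>. w \<sigma>)"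
    using fin by (subst sum.union_inter[symmetric]) (auto intro!: sum_nonneg w_nonneg)
  also have "\<dots> \<le> 2 * exp (- (s\<^sup>2 / (2 * v)))"
    using tail_le[OF assms] exchangeable_flips.tail_le[OF uminus assms] by simp
  finally show ?thesis .
qed

end

section \<open>Fourier analysis on the cube\<close>

lemma sum_Pow_by_card:
  fixes g :: "'a set \<Rightarrow> 'b::comm_monoid_add"
  assumes "finite I"
  shows "(\<Sum>S\<in>Pow I. g S) = (\<Sum>m\<le>card I. \<Sum>S | S \<subseteq> I \<and> card S = m. g S)"
proof -
  have "(\<Sum>m\<le>card I. sum g {S \<in> Pow I. card S = m}) = (\<Sum>S\<in>Pow I. g S)"
    using assms by (intro sum.group) (auto intro: card_mono)
  then show ?thesis by simp
qed

lemma sum_upto_even: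
  fixes g :: "nat \<Rightarrow> 'b::comm_monoid_add"
  assumes "\<And>m. even m \<Longrightarrow> g m = 0"
  shows "(\<Sum>m\<le>2 * d. g m) = (\<Sum>k<d. g (2 * k + 1))"
  using assms by (induction d) auto

lemma sum_upto_double:
  fixes g :: "nat \<Rightarrow> 'b::comm_monoid_add"
  shows "(\<Sum>k\<le>2 * d. g k) = g d + (\<Sum>j=1..d. g (d + j) + g (d - j))"
proof -
  have "(\<Sum>k\<le>2 * d. g k) = (\<Sum>k\<in>{..<d} \<union> ({d} \<union> {d+1..2*d}). g k)"
    by (rule sum.cong) auto
  also have "\<dots> = (\<Sum>k<d. g k) + (g d + (\<Sum>k=d+1..2*d. g k))"
    by (subst sum.union_disjoint; auto)
  also have "(\<Sum>k<d. g k) = (\<Sum>j=1..d. g (d - j))"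
    by (rule sum.reindex_bij_witness[of _ "\<lambda>j. d - j" "\<lambda>k. d - k"]) auto
  also have "(\<Sum>k=d+1..2*d. g k) = (\<Sum>j=1..d. g (d + j))"
    by (rule sum.reindex_bij_witness[of _ "\<lambda>j. d + j" "\<lambda>k. k - d"]) auto
  finally show ?thesis by (simp add: sum.distrib ac_simps)
qed

text \<open>Fourier inversion, with the factor 2^|I| left on the right: after exchanging the sums,
  the sum over S is the product of the factors s_i u_i + 1, which vanishes as soon as s and u differ
  in one coordinate.\<close>

lemma cube_fourier:
  fixes u :: "'a \<Rightarrow> real"
  assumes I: "finite I" and u: "\<And>i. i \<in> I \<Longrightarrow> u i \<in> {-1, 1}"
  shows "(\<Sum>S\<in>Pow I. (\<Sum>s\<in>I \<rightarrow>\<^sub>E {-1, 1}. g s * (\<Prod>i\<in>S. s i)) * (\<Prod>i\<in>S. u i))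
    = 2 ^ card I * g (restrict u I)"
proof -
  have fin: "finite (I \<rightarrow>\<^sub>E {-1, 1 :: real})" using I by (simp add: finite_PiE)
  have "(\<Sum>S\<in>Pow I. (\<Sum>s\<in>I \<rightarrow>\<^sub>E {-1, 1}. g s * (\<Prod>i\<in>S. s i)) * (\<Prod>i\<in>S. u i))
      = (\<Sum>S\<in>Pow I. \<Sum>s\<in>I \<rightarrow>\<^sub>E {-1, 1}. g s * (\<Prod>i\<in>S. s i * u i))"
    by (simp add: sum_distrib_right prod.distrib mult.assoc)
  also have "\<dots> = (\<Sum>s\<in>I \<rightarrow>\<^sub>E {-1, 1}. \<Sum>S\<in>Pow I. g s * (\<Prod>i\<in>S. s i * u i))"
    by (rule sum.swap)
  also have "\<dots> = (\<Sum>s\<in>I \<rightarrow>\<^sub>E {-1, 1}. if s = restrict u I then 2 ^ card I * g s else 0)"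
  proof (rule sum.cong)
    fix s assume s: "s \<in> I \<rightarrow>\<^sub>E {-1, 1 :: real}"
    have "(\<Sum>S\<in>Pow I. \<Prod>i\<in>S. s i * u i) = (\<Prod>i\<in>I. s i * u i + 1)"
      using prod_add[OF I, of "\<lambda>i. s i * u i" "\<lambda>_. 1"] by simp
    also have "\<dots> = (if s = restrict u I then 2 ^ card I else 0)"
    proof (cases "s = restrict u I")
      case True
      then have "(\<Prod>i\<in>I. s i * u i + 1) = (\<Prod>i\<in>I. 2)"
        using u by (intro prod.cong) force+
      then show ?thesis using True by simp
    next
      case False
      then obtain i where i: "s i \<noteq> restrict u I i" by blast
      then have "i \<in> I" using s by (cases "i \<in> I") (auto simp: PiE_def extensional_def)
      moreover from this have "s i * u i + 1 = 0"
        using i u[of i] PiE_mem[OF s, of i] by auto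
      ultimately show ?thesis using False I by auto
    qed
    finally show "(\<Sum>S\<in>Pow I. g s * (\<Prod>i\<in>S. s i * u i))
        = (if s = restrict u I then 2 ^ card I * g s else 0)"
      by (simp add: sum_distrib_left[symmetric])
  qed simp
  also have "\<dots> = 2 ^ card I * g (restrict u I)"
    using u fin by (subst sum.delta) auto
  finally show ?thesis .
qed

text \<open>A bijection of I onto J carrying S onto T transports the cube and preserves the
  coordinate sum. Hence a Fourier coefficient of a function of that sum depends only on the size of
  its index set.\<close>

lemma cube_sum_transfer:
  fixes h :: "real \<Rightarrow> real"
  assumes fin: "finite I" "finite J" and card: "card I = card J"
    and sub: "S \<subseteq> I" "T \<subseteq> J" and card': "card S = card T"
  shows "(\<Sum>s\<in>I \<rightarrow>\<^sub>E A. h (\<Sum>i\<in>I. s i) * (\<Prod>i\<in>S. s i))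
    = (\<Sum>s\<in>J \<rightarrow>\<^sub>E A. h (\<Sum>i\<in>J. s i) * (\<Prod>i\<in>T. s i))"
proof -
  have finS: "finite S" "finite T" using fin sub finite_subset by auto
  obtain a where a: "bij_betw a S T"
    using finite_same_card_bij[OF finS card'] by blast
  obtain b where b: "bij_betw b (I - S) (J - T)"
    using finite_same_card_bij[of "I - S" "J - T"] fin sub finS card card'
    by (auto simp: card_Diff_subset)
  define \<phi> where "\<phi> i = (if i \<in> S then a i else b i)" for i
  have S: "bij_betw \<phi> S T"
    using a by (rule bij_betw_cong[THEN iffD1, rotated]) (simp add: \<phi>_def)
  have "bij_betw \<phi> (I - S) (J - T)"
    using b by (rule bij_betw_cong[THEN iffD1, rotated]) (simp add: \<phi>_def)
  then have "bij_betw \<phi> (S \<union> (I - S)) (T \<union> (J - T))"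
    using S by (intro bij_betw_combine) auto
  then have I: "bij_betw \<phi> I J"
    using sub by (simp add: Un_absorb1)
  let ?\<psi> = "inv_into I \<phi>"
  have \<phi>: "\<phi> i \<in> J" "?\<psi> (\<phi> i) = i" if "i \<in> I" for i
    using I that by (auto simp: bij_betw_def)
  have \<psi>: "?\<psi> j \<in> I" "\<phi> (?\<psi> j) = j" if "j \<in> J" for j
    using I that by (auto simp: bij_betw_def inv_into_into f_inv_into_f)
  show ?thesis
  proof (rule sum.reindex_bij_witness[of _ "\<lambda>s. restrict (s \<circ> \<phi>) I" "\<lambda>s. restrict (s \<circ> ?\<psi>) J"])
    fix s assume s: "s \<in> I \<rightarrow>\<^sub>E A"
    show "restrict (restrict (s \<circ> ?\<psi>) J \<circ> \<phi>) I = s"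
      using s \<phi> by (auto simp: fun_eq_iff PiE_def extensional_def)
    show "restrict (s \<circ> ?\<psi>) J \<in> J \<rightarrow>\<^sub>E A"
      using s \<psi> by auto
    have "(\<Sum>j\<in>J. s (?\<psi> j)) = (\<Sum>i\<in>I. s i)"
      using \<phi> by (simp add: sum.reindex_bij_betw[OF I, symmetric])
    moreover have "(\<Prod>j\<in>T. s (?\<psi> j)) = (\<Prod>i\<in>S. s i)"
      using \<phi> sub by (auto simp: prod.reindex_bij_betw[OF S, symmetric] intro!: prod.cong)
    moreover have "(\<Prod>j\<in>T. restrict (s \<circ> ?\<psi>) J j) = (\<Prod>j\<in>T. s (?\<psi> j))"
      using sub by (intro prod.cong) auto
    ultimately show "h (\<Sum>j\<in>J. restrict (s \<circ> ?\<psi>) J j) * (\<Prod>j\<in>T. restrict (s \<circ> ?\<psi>) J j)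
        = h (\<Sum>i\<in>I. s i) * (\<Prod>i\<in>S. s i)"
      by simp
  next
    fix s assume s: "s \<in> J \<rightarrow>\<^sub>E A"
    show "restrict (restrict (s \<circ> \<phi>) I \<circ> ?\<psi>) J = s"
      using s \<psi> by (auto simp: fun_eq_iff PiE_def extensional_def)
    show "restrict (s \<circ> \<phi>) I \<in> I \<rightarrow>\<^sub>E A"
      using s \<phi> by auto
  qed
qed

text \<open>Reversing all signs is a bijection of the cube that negates \<open>h\<close> and leaves
  a product of evenly many signs alone, so the sum is its own negative.\<close>

lemma cube_sum_odd:
  fixes h :: "real \<Rightarrow> real"
  assumes h: "\<And>x. h (- x) = - h x" and sub: "S \<subseteq> I" and ev: "even (card S)"
  shows "(\<Sum>s\<in>I \<rightarrow>\<^sub>E {-1, 1}. h (\<Sum>i\<in>I. s i) * (\<Prod>i\<in>S. s i)) = 0" (is "?L = 0")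
proof -
  let ?m = "\<lambda>s. restrict (\<lambda>i. - s i) I"
  have "?L = (\<Sum>s\<in>I \<rightarrow>\<^sub>E {-1, 1}. - (h (\<Sum>i\<in>I. s i) * (\<Prod>i\<in>S. s i)))"
  proof (rule sum.reindex_bij_witness[of _ ?m ?m])
    fix s assume s: "s \<in> I \<rightarrow>\<^sub>E {-1, 1 :: real}"
    show "?m (?m s) = s"
      using s by (auto simp: fun_eq_iff PiE_def extensional_def)
    show "?m s \<in> I \<rightarrow>\<^sub>E {-1, 1}"
      using s by (force simp: PiE_iff)
    have "(\<Prod>i\<in>S. ?m s i) = (\<Prod>i\<in>S. - s i)"
      using sub by (intro prod.cong) auto
    also have "\<dots> = (\<Prod>i\<in>S. s i)"
      using ev by (simp add: prod_uminus)
    finally show "- (h (\<Sum>i\<in>I. ?m s i) * (\<Prod>i\<in>S. ?m s i)) = h (\<Sum>i\<in>I. s i) * (\<Prod>i\<in>S. s i)"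
      by (simp add: sum_negf h)
  next
    fix s assume s: "s \<in> I \<rightarrow>\<^sub>E {-1, 1 :: real}"
    show "?m (?m s) = s"
      using s by (auto simp: fun_eq_iff PiE_def extensional_def)
    show "?m s \<in> I \<rightarrow>\<^sub>E {-1, 1}"
      using s by (force simp: PiE_iff)
  qed
  then show ?thesis by (simp add: sum_negf)
qed

text \<open>A sign vector is coded by the set of its +1 coordinates; with k of these, the
  coordinates sum to k - (|I| - k).\<close>

lemma cube_sum_by_count:
  fixes h :: "real \<Rightarrow> real"
  assumes I: "finite I"
  shows "(\<Sum>s\<in>I \<rightarrow>\<^sub>E {-1, 1}. h (\<Sum>i\<in>I. s i))
    = (\<Sum>k\<le>card I. real (card I choose k) * h (2 * real k - real (card I)))"
proof -
  let ?s = "\<lambda>A. restrict (\<lambda>i. if i \<in> A then 1 else - 1 :: real) I"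
  have "(\<Sum>s\<in>I \<rightarrow>\<^sub>E {-1, 1}. h (\<Sum>i\<in>I. s i)) = (\<Sum>A\<in>Pow I. h (2 * real (card A) - real (card I)))"
  proof (rule sum.reindex_bij_witness[of _ ?s "\<lambda>s. {i \<in> I. s i = 1}"])
    fix s assume s: "s \<in> I \<rightarrow>\<^sub>E {-1, 1 :: real}"
    let ?A = "{i \<in> I. s i = 1}"
    show "?s ?A = s"
      using s by (force simp: fun_eq_iff PiE_iff extensional_def)
    have "(\<Sum>i\<in>I. s i) = (\<Sum>i\<in>I. 2 * of_bool (i \<in> ?A) - 1)"
      using s by (intro sum.cong) (auto simp: PiE_iff)
    also have "\<dots> = 2 * (\<Sum>i\<in>I. of_bool (i \<in> ?A)) - real (card I)"
      by (simp add: sum_subtractf sum_distrib_left)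
    also have "(\<Sum>i\<in>I. of_bool (i \<in> ?A)) = real (card ?A)"
      using I by (simp add: Int_def)
    finally show "h (2 * real (card ?A) - real (card I)) = h (\<Sum>i\<in>I. s i)" by simp
  qed (auto simp: PiE_iff)
  also have "\<dots> = (\<Sum>k\<le>card I. \<Sum>A | A \<subseteq> I \<and> card A = k. h (2 * real (card A) - real (card I)))"
    by (rule sum_Pow_by_card[OF I])
  also have "\<dots> = (\<Sum>k\<le>card I. real (card I choose k) * h (2 * real k - real (card I)))"
    using I by (intro sum.cong) (auto simp: n_subsets[symmetric])
  finally show ?thesis .
qed

text \<open>The Fourier coefficient of \<open>s \<mapsto> tanh (\<beta> * \<Sum>i. s i)\<close> on the cube \<open>{-1, 1}\<^bsup>2d\<^esup>\<close>
  at any set of \<open>2k+1\<close> coordinates.\<close>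

definition tanh_coeff :: "nat \<Rightarrow> nat \<Rightarrow> real \<Rightarrow> real" where
  "tanh_coeff d k \<beta> = (1 / 4 ^ d) * (\<Sum>s\<in>{1..2 * d} \<rightarrow>\<^sub>E {-1, 1 :: real}.
     tanh (\<beta> * (\<Sum>i=1..2 * d. s i)) * (\<Prod>j=1..2 * k + 1. s j))"

lemma theta_eq_tanh_coeff: "theta d k \<beta> = real ((2 * d) choose (2 * k + 1)) * tanh_coeff d k \<beta>"
  by (simp add: theta_def tanh_coeff_def)

text \<open>Inversion by \<open>cube_fourier\<close>. Coefficients at even sets vanish because tanh
  is odd, and by \<open>cube_sum_transfer\<close> those at sets of size 2k+1 all agree with the
  model one on {1..2d}. The factor 2^(2d) is the 4^d in \<open>tanh_coeff\<close>.\<close>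

lemma tanh_expansion:
  fixes u :: "'a \<Rightarrow> real"
  assumes I: "finite I" "card I = 2 * d" and u: "\<And>i. i \<in> I \<Longrightarrow> u i \<in> {-1, 1}"
  shows "tanh (\<beta> * (\<Sum>i\<in>I. u i))
    = (\<Sum>k<d. tanh_coeff d k \<beta> * (\<Sum>S | S \<subseteq> I \<and> card S = 2 * k + 1. \<Prod>i\<in>S. u i))"
proof -
  let ?h = "\<lambda>x. tanh (\<beta> * x)"
  let ?c = "\<lambda>S. \<Sum>s\<in>I \<rightarrow>\<^sub>E {-1, 1}. ?h (\<Sum>i\<in>I. s i) * (\<Prod>i\<in>S. s i)"
  let ?g = "\<lambda>m. \<Sum>S | S \<subseteq> I \<and> card S = m. ?c S * (\<Prod>i\<in>S. u i)"
  have even: "?g m = 0" if "even m" for m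
  proof (rule sum.neutral, rule ballI)
    fix S assume "S \<in> {S. S \<subseteq> I \<and> card S = m}"
    then have "?c S = 0" using that by (intro cube_sum_odd) auto
    then show "?c S * (\<Prod>i\<in>S. u i) = 0" by simp
  qed
  have odd: "?g (2 * k + 1)
      = 4 ^ d * (tanh_coeff d k \<beta> * (\<Sum>S | S \<subseteq> I \<and> card S = 2 * k + 1. \<Prod>i\<in>S. u i))"
    if k: "k < d" for k
  proof -
    have "?c S = 4 ^ d * tanh_coeff d k \<beta>" if "S \<subseteq> I" "card S = 2 * k + 1" for S
      unfolding tanh_coeff_def using that I k
      by (subst cube_sum_transfer[of I "{1..2 * d}" S "{1..2 * k + 1}" ?h]) auto
    then show ?thesis
      by (simp add: sum_distrib_left mult.assoc)
  qed
  have "4 ^ d * ?h (\<Sum>i\<in>I. u i) = (\<Sum>S\<in>Pow I. ?c S * (\<Prod>i\<in>S. u i))"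
    using cube_fourier[of I u "\<lambda>s. ?h (\<Sum>i\<in>I. s i)"] I u by (simp add: power_mult)
  also have "\<dots> = (\<Sum>m\<le>2 * d. ?g m)"
    using sum_Pow_by_card[OF I(1)] I(2) by simp
  also have "\<dots> = (\<Sum>k<d. ?g (2 * k + 1))"
    by (rule sum_upto_even[OF even])
  also have "\<dots> = 4 ^ d * (\<Sum>k<d. tanh_coeff d k \<beta> *
      (\<Sum>S | S \<subseteq> I \<and> card S = 2 * k + 1. \<Prod>i\<in>S. u i))"
    unfolding sum_distrib_left[of "4 ^ d"] by (intro sum.cong odd) auto
  finally show ?thesis by simp
qed

section \<open>The coefficient \<open>\<theta>\<^sub>0\<close>\<close>

text \<open>All 2d coordinates contribute equally, so theta_0 is the mean of X tanh(beta X) for a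
  sum X of 2d independent fair signs. Counting the values of X gives the formula.\<close>

lemma theta_0_eq:
  assumes "d \<ge> 1"
  shows "theta d 0 \<beta> = (1 / 4 ^ (d - 1)) *
    (\<Sum>k=1..d. real k * real ((2 * d) choose (d + k)) * tanh (2 * real k * \<beta>))"
proof -
  let ?I = "{1..2 * d}"
  let ?h = "\<lambda>x. tanh (\<beta> * x)"
  let ?c = "\<lambda>i. \<Sum>s\<in>?I \<rightarrow>\<^sub>E {-1, 1}. ?h (\<Sum>i\<in>?I. s i) * (\<Prod>i\<in>{i}. s i)"
  let ?g = "\<lambda>k. real ((2 * d) choose k) * (?h (2 * real k - 2 * real d) * (2 * real k - 2 * real d))"
  have "4 ^ d * theta d 0 \<beta> = (\<Sum>i\<in>?I. ?c 1)"
    by (simp add: theta_def)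
  also have "\<dots> = (\<Sum>i\<in>?I. ?c i)"
    using assms by (intro sum.cong refl cube_sum_transfer) auto
  also have "\<dots> = (\<Sum>s\<in>?I \<rightarrow>\<^sub>E {-1, 1}. \<Sum>i\<in>?I. ?h (\<Sum>i\<in>?I. s i) * s i)"
    by (subst sum.swap) simp
  also have "\<dots> = (\<Sum>s\<in>?I \<rightarrow>\<^sub>E {-1, 1}. ?h (\<Sum>i\<in>?I. s i) * (\<Sum>i\<in>?I. s i))"
    by (simp add: sum_distrib_left)
  also have "\<dots> = (\<Sum>k\<le>2 * d. ?g k)"
    using cube_sum_by_count[of ?I "\<lambda>x. ?h x * x"] by simp
  also have "\<dots> = ?g d + (\<Sum>j=1..d. ?g (d + j) + ?g (d - j))"
    by (rule sum_upto_double)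
  \<comment> \<open>The centre X = 0 contributes nothing, and X = 2j and X = -2j contribute equally,
    each with a factor 2j: hence the 4, which lowers 4^d to 4^(d-1).\<close>
  also have "\<dots> = (\<Sum>j=1..d. 4 * (real j * real ((2 * d) choose (d + j)) * tanh (2 * real j * \<beta>)))"
  proof -
    have "?g (d + j) + ?g (d - j) = 4 * (real j * real ((2 * d) choose (d + j)) * tanh (2 * real j * \<beta>))"
      if "j \<in> {1..d}" for j
    proof -
      have j: "j \<le> d" using that by simp
      have "(2 * d) choose (d - j) = (2 * d) choose (d + j)"
        using binomial_symmetric[of "d - j" "2 * d"] j by (simp add: algebra_simps)
      moreover have "tanh (\<beta> * (2 * real (d - j) - 2 * real d)) = - tanh (2 * real j * \<beta>)"
        using j by (simp add: of_nat_diff algebra_simps flip: tanh_minus)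
      moreover have "2 * real (d - j) - 2 * real d = - (2 * real j)"
        using j by (simp add: of_nat_diff)
      ultimately show ?thesis by (simp add: algebra_simps)
    qed
    then show ?thesis by simp
  qed
  also have "\<dots> = 4 * (\<Sum>j=1..d. real j * real ((2 * d) choose (d + j)) * tanh (2 * real j * \<beta>))"
    by (simp add: sum_distrib_left)
  finally have "4 ^ d * theta d 0 \<beta>
      = 4 * (\<Sum>j=1..d. real j * real ((2 * d) choose (d + j)) * tanh (2 * real j * \<beta>))" .
  moreover have "(4 :: real) ^ d = 4 * 4 ^ (d - 1)"
    using assms by (cases d) auto
  ultimately show ?thesis by (simp add: field_simps)
qed

text \<open>Evaluates the limit of theta_0 at infinity. Since (d - m) C(2d, d+m) = (d+m+1) C(2d,
  d+m+1), the term of index m+1 is the drop of (d - m) C(2d, d+m) from m to m+1, and the sum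
  telescopes.\<close>

lemma sum_mult_central_choose:
  "(\<Sum>k=1..d. 2 * k * ((2 * d) choose (d + k))) = d * ((2 * d) choose d)"
proof -
  have "(\<Sum>k=1..m. 2 * k * ((2 * d) choose (d + k))) + (d - m) * ((2 * d) choose (d + m))
      = d * ((2 * d) choose d)" if "m \<le> d" for m
    using that
  proof (induction m)
    case (Suc m)
    have "(d - m) * ((2 * d) choose (d + m)) = (d + Suc m) * ((2 * d) choose (d + Suc m))"
      using binomial_absorb_comp[of "2 * d" "d + m"] binomial_absorption[of "d + m" "2 * d"] by simp
    also have "\<dots> = (2 * Suc m + (d - Suc m)) * ((2 * d) choose (d + Suc m))"
      by (rule arg_cong2[of _ _ _ _ "(*)"]) (use Suc.prems in auto)
    also have "\<dots> = 2 * Suc m * ((2 * d) choose (d + Suc m)) + (d - Suc m) * ((2 * d) choose (d + Suc m))"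
      by (rule distrib_right)
    finally show ?case using Suc by simp
  qed simp
  from this[of d] show ?thesis by simp
qed

text \<open>Puts the limit of theta_0 above 1. From d to d+1 the left side grows by the factor 4,
  the right side by 4 + 2/d; at d = 1 both sides are 4, so the induction starts at 2.\<close>

lemma central_choose_gt:
  assumes "d \<ge> 2"
  shows "4 ^ d < 2 * d * ((2 * d) choose d)"
  using assms
proof (induction d rule: dec_induct)
  case base
  then show ?case by (simp add: numeral_eq_Suc)
next
  case (step d)
  have "Suc d * ((2 * Suc d) choose Suc d) = 2 * (2 * d + 1) * ((2 * d) choose d)"
  proof -
    have "Suc d * ((2 * Suc d) choose Suc d) = 2 * (Suc d * (Suc (2 * d) choose d))"
      using Suc_times_binomial_eq[of "Suc (2 * d)" d] by (simp add: algebra_simps)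
    also have "Suc (2 * d) choose d = Suc (2 * d) choose Suc d"
      using binomial_symmetric[of d "Suc (2 * d)"] by simp
    also have "Suc d * (Suc (2 * d) choose Suc d) = (2 * d + 1) * ((2 * d) choose d)"
      using Suc_times_binomial_eq[of "2 * d" d] by (simp add: mult.commute)
    finally show ?thesis by simp
  qed
  moreover have "4 * (2 * d * ((2 * d) choose d)) \<le> 2 * (2 * (2 * d + 1) * ((2 * d) choose d))"
    by simp
  ultimately show ?case using step.IH by simp
qed

text \<open>Every tanh term is continuous and strictly increasing, so theta_0, which is 0 at 0 and
  has a limit above 1, crosses 1 exactly once.\<close>

lemma theta_0_threshold:
  assumes d: "d \<ge> 2"
  shows "\<exists>\<beta>\<^sub>1>0. \<forall>\<beta>\<ge>0. (\<beta> < \<beta>\<^sub>1 \<longrightarrow> 1 - theta d 0 \<beta> > 0) \<and> (\<beta> > \<beta>\<^sub>1 \<longrightarrow> 1 - theta d 0 \<beta> < 0)"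
proof -
  let ?c = "\<lambda>k. real k * real ((2 * d) choose (d + k))"
  have eq: "theta d 0 = (\<lambda>\<beta>. (1 / 4 ^ (d - 1)) * (\<Sum>k=1..d. ?c k * tanh (2 * real k * \<beta>)))"
    using theta_0_eq[of d] d by (simp add: fun_eq_iff)
  have mono: "theta d 0 x < theta d 0 y" if "x < y" for x y
  proof -
    have "(\<Sum>k=1..d. ?c k * tanh (2 * real k * x)) < (\<Sum>k=1..d. ?c k * tanh (2 * real k * y))"
      using that d by (intro sum_strict_mono mult_strict_left_mono) auto
    then show ?thesis by (simp add: eq divide_strict_right_mono)
  qed
  have cont: "continuous_on A (theta d 0)" for A
    unfolding eq by (intro continuous_intros) auto
  have "((\<lambda>\<beta>. tanh (2 * real k * \<beta>)) \<longlongrightarrow> 1) at_top" if "k \<in> {1..d}" for k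
    using that by (intro filterlim_compose[OF tanh_real_at_top]
        filterlim_tendsto_pos_mult_at_top[OF tendsto_const _ filterlim_ident]) auto
  then have "(theta d 0 \<longlongrightarrow> (1 / 4 ^ (d - 1)) * (\<Sum>k=1..d. ?c k * 1)) at_top"
    unfolding eq by (intro tendsto_intros)
  moreover have "(1 / 4 ^ (d - 1)) * (\<Sum>k=1..d. ?c k * 1) > 1"
  proof -
    have "2 * (\<Sum>k=1..d. ?c k * 1) = real (d * ((2 * d) choose d))"
      unfolding sum_mult_central_choose[symmetric] by (simp add: sum_distrib_left mult.assoc)
    moreover have "(4 :: real) * 4 ^ (d - 1) = 4 ^ d"
      using d by (cases d) auto
    moreover have "real (4 ^ d) < real (2 * d * ((2 * d) choose d))"
      using central_choose_gt[OF d] by (simp only: of_nat_less_iff)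
    ultimately show ?thesis by (simp add: field_simps)
  qed
  ultimately have "eventually (\<lambda>\<beta>. theta d 0 \<beta> > 1) at_top"
    by (rule order_tendstoD)
  then obtain b where b: "b > 0" "theta d 0 b > 1"
    using eventually_happens'[OF _ eventually_conj[OF _ eventually_gt_at_top[of 0]]]
      trivial_limit_at_top_linorder by blast
  have "theta d 0 0 = 0" by (simp add: eq)
  then obtain \<beta>\<^sub>1 where "0 \<le> \<beta>\<^sub>1" "theta d 0 \<beta>\<^sub>1 = 1"
    using IVT'[of "theta d 0" 0 1 b] b cont by auto
  moreover from this have "\<beta>\<^sub>1 \<noteq> 0" using \<open>theta d 0 0 = 0\<close> by auto
  ultimately show ?thesis
    using mono by (intro exI[of _ \<beta>\<^sub>1]) fastforce
qed

section \<open>Single spin flips in the Ising model\<close>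

lemma step_opposite:
  assumes "x \<in> torus d n" "e \<in> dirs d"
  shows "step n (step n x e) (fst e, - snd e) = x"
proof -
  have x: "x (fst e) \<in> {1..int n}" using assms by (auto simp: torus_def dirs_def)
  have "((x (fst e) + snd e - 1) mod int n + 1 + - snd e - 1) mod int n
      = ((x (fst e) + snd e - 1) mod int n - snd e) mod int n" by simp
  also have "\<dots> = (x (fst e) - 1) mod int n"
    by (simp add: mod_diff_left_eq)
  also have "\<dots> = x (fst e) - 1"
    using x by simp
  finally show ?thesis by (simp add: step_def)
qed

lemma opposite_in_dirs: "e \<in> dirs d \<Longrightarrow> (fst e, - snd e) \<in> dirs d"
  by (auto simp: dirs_def)

text \<open>Excludes loops, which do occur for n = 1. Thus the local field at a site does not
  involve the spin there.\<close>

lemma step_neq: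
  assumes "n \<ge> 2" "x \<in> torus d n" "e \<in> dirs d"
  shows "step n x e \<noteq> x"
proof
  assume eq: "step n x e = x"
  have x: "x (fst e) \<in> {1..int n}" and e: "snd e \<in> {-1, 1}"
    using assms by (auto simp: torus_def dirs_def)
  have "(x (fst e) + snd e - 1) mod int n + 1 = x (fst e)"
    using fun_cong[OF eq, of "fst e"] by (simp add: step_def)
  then show False
    using e assms(1) coord_step[OF assms(1) x] by (auto split: if_splits)
qed

text \<open>Moving along a fixed direction is a translation of the torus, inverted by the opposite
  direction.\<close>

lemma sum_step:
  assumes "n \<ge> 1" "e \<in> dirs d"
  shows "(\<Sum>x\<in>torus d n. g (step n x e)) = (\<Sum>x\<in>torus d n. g x)"
proof (rule sum.reindex_bij_witness[of _ "\<lambda>x. step n x (fst e, - snd e)" "\<lambda>x. step n x e"])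
  let ?e' = "(fst e, - snd e)"
  fix x assume x: "x \<in> torus d n"
  show "step n (step n x e) ?e' = x" by (rule step_opposite[OF x assms(2)])
  show "step n x e \<in> torus d n" by (rule step_in_torus[OF assms(1) x assms(2)])
  show "step n x ?e' \<in> torus d n"
    by (rule step_in_torus[OF assms(1) x opposite_in_dirs[OF assms(2)]])
  show "step n (step n x ?e') e = x"
    using step_opposite[OF x opposite_in_dirs[OF assms(2)]] by simp
qed simp

definition flip :: "'a \<Rightarrow> ('a \<Rightarrow> real) \<Rightarrow> 'a \<Rightarrow> real" where
  "flip x \<sigma> = \<sigma>(x := - \<sigma> x)"

text \<open>Directions are summed rather than distinct neighbours, so for n = 2 a neighbour counts
  twice, in agreement with the doubled edges in \<open>energy\<close>.\<close>

definition local_field :: "nat \<Rightarrow> nat \<Rightarrow> (nat \<Rightarrow> int) \<Rightarrow> ((nat \<Rightarrow> int) \<Rightarrow> real) \<Rightarrow> real" where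
  "local_field d n x \<sigma> = (\<Sum>e\<in>dirs d. \<sigma> (step n x e))"

lemma flip_flip [simp]: "flip x (flip x \<sigma>) = \<sigma>"
  by (simp add: flip_def)

lemma flip_same [simp]: "flip x \<sigma> x = - \<sigma> x"
  and flip_other [simp]: "y \<noteq> x \<Longrightarrow> flip x \<sigma> y = \<sigma> y"
  by (simp_all add: flip_def)

lemma configs_values: "\<sigma> \<in> configs d n \<Longrightarrow> x \<in> torus d n \<Longrightarrow> \<sigma> x \<in> {-1, 1}"
  by (auto simp: configs_def)

lemma flip_in_configs: "x \<in> torus d n \<Longrightarrow> \<sigma> \<in> configs d n \<Longrightarrow> flip x \<sigma> \<in> configs d n"
  by (force simp: configs_def flip_def PiE_iff extensional_def)

lemma local_field_flip:
  assumes "n \<ge> 2" "x \<in> torus d n"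
  shows "local_field d n x (flip x \<sigma>) = local_field d n x \<sigma>"
  unfolding local_field_def using step_neq[OF assms] by (intro sum.cong) auto

lemma energy_flip:
  assumes n: "n \<ge> 2" and x: "x \<in> torus d n"
  shows "energy d n \<sigma> - energy d n (flip x \<sigma>) = 2 * \<sigma> x * local_field d n x \<sigma>"
proof -
  let ?\<sigma>' = "flip x \<sigma>"
  have dir: "(\<Sum>z\<in>torus d n. \<sigma> z * \<sigma> (step n z (i, 1)) - ?\<sigma>' z * ?\<sigma>' (step n z (i, 1)))
      = 2 * \<sigma> x * (\<sigma> (step n x (i, 1)) + \<sigma> (step n x (i, -1)))" if i: "i \<in> {1..d}" for i
  proof -
    let ?y = "step n x (i, -1)"
    have mem: "(i, 1) \<in> dirs d" "(i, -1) \<in> dirs d" using i by (auto simp: dirs_def)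
    have y: "?y \<in> torus d n" "?y \<noteq> x" "step n ?y (i, 1) = x"
      using step_in_torus[OF _ x mem(2)] step_neq[OF n x mem(2)] step_inverse[OF n x i] n by auto
    \<comment> \<open>The site \<open>x\<close> enters direction \<open>i\<close> twice: as base
      point of its own edge and as end point of the edge based at \<open>?y\<close>. These base
      points differ even for n = 2.\<close>
    have "\<sigma> z * \<sigma> (step n z (i, 1)) - ?\<sigma>' z * ?\<sigma>' (step n z (i, 1))
        = (if z = x then 2 * \<sigma> x * \<sigma> (step n x (i, 1)) else 0)
          + (if z = ?y then 2 * \<sigma> x * \<sigma> ?y else 0)" if z: "z \<in> torus d n" for z
    proof -
      consider "z = x" | "z = ?y" | "z \<noteq> x" "z \<noteq> ?y" by blast
      then show ?thesis
      proof cases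
        case 1
        then show ?thesis using y(2) step_neq[OF n x mem(1)] by auto
      next
        case 2
        then show ?thesis using y by auto
      next
        case 3
        then have "step n z (i, 1) \<noteq> x" using step_opposite[OF z mem(1)] by auto
        then show ?thesis using 3 by simp
      qed
    qed
    then have "(\<Sum>z\<in>torus d n. \<sigma> z * \<sigma> (step n z (i, 1)) - ?\<sigma>' z * ?\<sigma>' (step n z (i, 1)))
        = (\<Sum>z\<in>torus d n. (if z = x then 2 * \<sigma> x * \<sigma> (step n x (i, 1)) else 0)
          + (if z = ?y then 2 * \<sigma> x * \<sigma> ?y else 0))"
      by (intro sum.cong) auto
    also have "\<dots> = 2 * \<sigma> x * (\<sigma> (step n x (i, 1)) + \<sigma> ?y)"
      using x y(1) by (simp add: sum.distrib sum.delta' algebra_simps)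
    finally show ?thesis .
  qed
  have "energy d n \<sigma> - energy d n ?\<sigma>'
      = (\<Sum>i=1..d. \<Sum>z\<in>torus d n. \<sigma> z * \<sigma> (step n z (i, 1)) - ?\<sigma>' z * ?\<sigma>' (step n z (i, 1)))"
    unfolding energy_def sum_subtractf[symmetric] by (rule sum.swap)
  also have "\<dots> = (\<Sum>i=1..d. 2 * \<sigma> x * (\<sigma> (step n x (i, 1)) + \<sigma> (step n x (i, -1))))"
    by (intro sum.cong refl dir)
  also have "\<dots> = 2 * \<sigma> x * (\<Sum>i=1..d. \<Sum>s\<in>{-1, 1}. \<sigma> (step n x (i, s)))"
    by (simp add: sum_distrib_left add.commute)
  also have "(\<Sum>i=1..d. \<Sum>s\<in>{-1, 1}. \<sigma> (step n x (i, s))) = local_field d n x \<sigma>"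
    by (simp only: local_field_def dirs_def sum.cartesian_product case_prod_unfold prod.collapse)
  finally show ?thesis .
qed

text \<open>Detailed balance for one spin: the Gibbs weight ratio e^(-2z) of the flipped to the
  original configuration offsets the ratio of their flip probabilities (1 + tanh z)/2 and (1 - tanh
  z)/2.\<close>

lemma tanh_balance: "exp (- (2 * z)) * (1 + tanh z) = 1 - tanh z" for z :: real
proof -
  have "1 + exp (- (2 * z)) > 0" by (intro add_pos_pos) auto
  then show ?thesis by (simp add: tanh_real_altdef field_simps)
qed

lemma magnetization_flip:
  assumes "x \<in> torus d n" "\<sigma> \<in> configs d n"
  shows "\<bar>magnetization d n \<sigma> - magnetization d n (flip x \<sigma>)\<bar> \<le> 2 / real (card (torus d n))"
proof -
  have "(\<Sum>z\<in>torus d n. \<sigma> z) - (\<Sum>z\<in>torus d n. flip x \<sigma> z)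
      = (\<Sum>z\<in>torus d n. if z = x then 2 * \<sigma> x else 0)"
    unfolding sum_subtractf[symmetric] by (intro sum.cong) auto
  also have "\<dots> = 2 * \<sigma> x"
    using assms by simp
  finally have "magnetization d n \<sigma> - magnetization d n (flip x \<sigma>)
      = 2 * \<sigma> x / real (card (torus d n))"
    by (simp add: magnetization_def diff_divide_distrib[symmetric])
  then show ?thesis using configs_values[OF assms(2,1)] by auto
qed

text \<open>For each direction exactly one site steps to x, so a fixed set S of k directions meets x
  k times in all, and each meeting changes a product by at most 2. The number of sets S cancels
  against the normalisation.\<close>

lemma nbr_corr_flip:
  assumes n: "n \<ge> 1" and x: "x \<in> torus d n" and \<sigma>: "\<sigma> \<in> configs d n" and k: "k \<le> 2 * d"
  shows "\<bar>nbr_corr d n k \<sigma> - nbr_corr d n k (flip x \<sigma>)\<bar> \<le> 2 * real k / real (card (torus d n))"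
proof -
  let ?N = "real (card (torus d n))" and ?C = "real ((2 * d) choose k)"
  let ?D = "{S. S \<subseteq> dirs d \<and> card S = k}"
  have pos: "?C > 0" using k by simp
  have "\<bar>(\<Sum>z\<in>torus d n. \<Sum>S\<in>?D. \<Prod>e\<in>S. \<sigma> (step n z e))
        - (\<Sum>z\<in>torus d n. \<Sum>S\<in>?D. \<Prod>e\<in>S. flip x \<sigma> (step n z e))\<bar>
      \<le> (\<Sum>z\<in>torus d n. \<Sum>S\<in>?D. \<Sum>e\<in>S. if step n z e = x then 2 else 0)"
    unfolding sum_subtractf[symmetric]
  proof (intro order.trans[OF sum_abs] sum_mono)
    fix z S assume z: "z \<in> torus d n" and S: "S \<in> ?D"
    have mem: "step n z e \<in> torus d n" if "e \<in> S" for e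
      using step_in_torus[OF n z] that S by blast
    have "\<bar>(\<Prod>e\<in>S. \<sigma> (step n z e)) - (\<Prod>e\<in>S. flip x \<sigma> (step n z e))\<bar>
        \<le> (\<Sum>e\<in>S. \<bar>\<sigma> (step n z e) - flip x \<sigma> (step n z e)\<bar>)"
      \<comment> \<open>As the factors have modulus 1, the difference of products is at most the sum
        of the differences of factors. This covers n = 2, where \<open>x\<close> can occur twice in
        one product.\<close>
      using norm_prod_diff[of S "\<lambda>e. \<sigma> (step n z e)" "\<lambda>e. flip x \<sigma> (step n z e)"]
        configs_values[OF \<sigma> mem] configs_values[OF flip_in_configs[OF x \<sigma>] mem] by force
    also have "\<dots> \<le> (\<Sum>e\<in>S. if step n z e = x then 2 else 0)"
      using configs_values[OF \<sigma> x] by (intro sum_mono) auto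
    finally show "\<bar>(\<Prod>e\<in>S. \<sigma> (step n z e)) - (\<Prod>e\<in>S. flip x \<sigma> (step n z e))\<bar>
        \<le> (\<Sum>e\<in>S. if step n z e = x then 2 else 0)" .
  qed
  also have "\<dots> = (\<Sum>S\<in>?D. \<Sum>z\<in>torus d n. \<Sum>e\<in>S. if step n z e = x then 2 else 0)"
    by (rule sum.swap)
  also have "\<dots> = (\<Sum>S\<in>?D. \<Sum>e\<in>S. \<Sum>z\<in>torus d n. if step n z e = x then 2 else 0)"
    by (intro sum.cong refl sum.swap)
  also have "\<dots> = (\<Sum>S\<in>?D. \<Sum>e\<in>S. 2)"
  proof (intro sum.cong refl)
    fix S e assume "S \<in> ?D" "e \<in> S"
    then have "e \<in> dirs d" by auto
    then show "(\<Sum>z\<in>torus d n. if step n z e = x then 2 else 0) = (2 :: real)"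
      using sum_step[OF n, of e d "\<lambda>z. if z = x then 2 else 0"] x by simp
  qed
  also have "\<dots> = ?C * (2 * real k)"
    by (simp add: n_subsets card_dirs)
  finally have "inverse (?C * ?N) * \<bar>(\<Sum>z\<in>torus d n. \<Sum>S\<in>?D. \<Prod>e\<in>S. \<sigma> (step n z e))
        - (\<Sum>z\<in>torus d n. \<Sum>S\<in>?D. \<Prod>e\<in>S. flip x \<sigma> (step n z e))\<bar>
      \<le> inverse (?C * ?N) * (?C * (2 * real k))"
    by (intro mult_left_mono) auto
  also have "\<dots> = 2 * real k / ?N"
    using pos by (simp add: divide_inverse)
  finally show ?thesis
    by (simp add: nbr_corr_def right_diff_distrib[symmetric] abs_mult)
qed

text \<open>Each of the 2d directions contributes the total spin, by \<open>sum_step\<close>. This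
  lets the linear part of the tanh expansion be written with the magnetization.\<close>

lemma nbr_corr_1:
  assumes "n \<ge> 1" "d \<ge> 1"
  shows "nbr_corr d n 1 \<sigma> = magnetization d n \<sigma>"
proof -
  have "(\<Sum>S | S \<subseteq> dirs d \<and> card S = 1. \<Prod>e\<in>S. \<sigma> (step n x e)) = (\<Sum>e\<in>dirs d. \<sigma> (step n x e))" for x
    by (rule sum.reindex_bij_witness[of _ "\<lambda>e. {e}" the_elem]) (auto simp: card_1_singleton_iff)
  then have "nbr_corr d n 1 \<sigma> = inverse (real (2 * d) * real (card (torus d n))) *
      (\<Sum>e\<in>dirs d. \<Sum>x\<in>torus d n. \<sigma> (step n x e))"
    by (simp add: nbr_corr_def sum.swap[of _ "dirs d"])
  also have "(\<Sum>e\<in>dirs d. \<Sum>x\<in>torus d n. \<sigma> (step n x e)) = real (2 * d) * (\<Sum>x\<in>torus d n. \<sigma> x)"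
    using assms by (simp add: sum_step card_dirs)
  finally show ?thesis
    using assms by (simp add: magnetization_def field_simps)
qed

section \<open>The statistic, its exchangeable pair and the tail bound\<close>

definition statistic :: "nat \<Rightarrow> nat \<Rightarrow> real \<Rightarrow> ((nat \<Rightarrow> int) \<Rightarrow> real) \<Rightarrow> real" where
  "statistic d n \<beta> \<sigma> = (1 - theta d 0 \<beta>) * magnetization d n \<sigma>
     - (\<Sum>k=1..d - 1. theta d k \<beta> * nbr_corr d n (2 * k + 1) \<sigma>)"

lemma bcoeff_nonneg: "bcoeff d \<beta> \<ge> 0"
  unfolding bcoeff_def by (intro add_nonneg_nonneg sum_nonneg) auto

text \<open>The weights in \<open>bcoeff\<close> come from here: a flip moves m by at most 2/N and
  the correlation of order 2k+1 by at most 2(2k+1)/N.\<close>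

lemma statistic_flip:
  assumes n: "n \<ge> 1" and x: "x \<in> torus d n" and \<sigma>: "\<sigma> \<in> configs d n"
  shows "\<bar>statistic d n \<beta> \<sigma> - statistic d n \<beta> (flip x \<sigma>)\<bar>
    \<le> 2 * bcoeff d \<beta> / real (card (torus d n))"
proof -
  let ?N = "real (card (torus d n))"
  let ?m = "magnetization d n \<sigma> - magnetization d n (flip x \<sigma>)"
  let ?r = "\<lambda>k. nbr_corr d n (2 * k + 1) \<sigma> - nbr_corr d n (2 * k + 1) (flip x \<sigma>)"
  have "\<bar>statistic d n \<beta> \<sigma> - statistic d n \<beta> (flip x \<sigma>)\<bar>
      = \<bar>(1 - theta d 0 \<beta>) * ?m - (\<Sum>k=1..d - 1. theta d k \<beta> * ?r k)\<bar>"
    by (simp add: statistic_def right_diff_distrib sum_subtractf)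
  also have "\<dots> \<le> \<bar>1 - theta d 0 \<beta>\<bar> * \<bar>?m\<bar> + (\<Sum>k=1..d - 1. \<bar>theta d k \<beta>\<bar> * \<bar>?r k\<bar>)"
    unfolding abs_mult[symmetric]
    by (rule order.trans[OF abs_triangle_ineq4 add_left_mono[OF sum_abs]])
  also have "\<dots> \<le> \<bar>1 - theta d 0 \<beta>\<bar> * (2 / ?N)
      + (\<Sum>k=1..d - 1. \<bar>theta d k \<beta>\<bar> * (2 * real (2 * k + 1) / ?N))"
    by (intro add_mono mult_left_mono sum_mono magnetization_flip nbr_corr_flip n x \<sigma>) auto
  also have "\<dots> = 2 * bcoeff d \<beta> / ?N"
    by (simp add: bcoeff_def sum_distrib_left sum_divide_distrib add_divide_distrib mult_ac distrib_left)
  finally show ?thesis .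
qed

text \<open>Sums \<open>tanh_expansion\<close> over all sites, with the neighbouring spins as signs;
  \<open>nbr_corr_1\<close> identifies the part of degree 1.\<close>

lemma statistic_drift:
  assumes n: "n \<ge> 1" and d: "d \<ge> 1" and \<sigma>: "\<sigma> \<in> configs d n"
  shows "statistic d n \<beta> \<sigma>
    = (\<Sum>x\<in>torus d n. (\<sigma> x - tanh (\<beta> * local_field d n x \<sigma>)) / real (card (torus d n)))"
proof -
  let ?N = "real (card (torus d n))"
  let ?P = "\<lambda>k x. \<Sum>S | S \<subseteq> dirs d \<and> card S = 2 * k + 1. \<Prod>e\<in>S. \<sigma> (step n x e)"
  have N: "?N > 0" using n by (simp add: card_torus)
  then have N': "torus d n \<noteq> {}" by auto
  have "(\<Sum>x\<in>torus d n. tanh (\<beta> * local_field d n x \<sigma>))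
      = (\<Sum>x\<in>torus d n. \<Sum>k<d. tanh_coeff d k \<beta> * ?P k x)"
    unfolding local_field_def
    by (intro sum.cong refl tanh_expansion finite_dirs card_dirs configs_values[OF \<sigma>] step_in_torus n)
  also have "\<dots> = (\<Sum>k<d. tanh_coeff d k \<beta> * (\<Sum>x\<in>torus d n. ?P k x))"
    by (subst sum.swap) (simp add: sum_distrib_left)
  \<comment> \<open>The binomial in \<open>theta\<close> cancels the one in the normalisation of
    \<open>nbr_corr\<close>.\<close>
  also have "\<dots> = (\<Sum>k<d. ?N * (theta d k \<beta> * nbr_corr d n (2 * k + 1) \<sigma>))"
    using N by (intro sum.cong) (auto simp: theta_eq_tanh_coeff nbr_corr_def field_simps)
  also have "\<dots> = ?N * (\<Sum>k<d. theta d k \<beta> * nbr_corr d n (2 * k + 1) \<sigma>)"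
    by (simp add: sum_distrib_left)
  also have "{..<d} = insert 0 {1..d - 1}"
    using d by auto
  finally have "(\<Sum>x\<in>torus d n. tanh (\<beta> * local_field d n x \<sigma>)) / ?N
      = theta d 0 \<beta> * magnetization d n \<sigma> + (\<Sum>k=1..d - 1. theta d k \<beta> * nbr_corr d n (2 * k + 1) \<sigma>)"
    using N' nbr_corr_1[OF n d, of \<sigma>] by simp
  then show ?thesis
    by (simp add: statistic_def magnetization_def sum_subtractf diff_divide_distrib
        sum_divide_distrib[symmetric] left_diff_distrib)
qed

text \<open>Heat-bath dynamics: a site is chosen with probability 1/N and its spin resampled, which
  flips it with probability (1 - sigma_x tanh(beta h_x))/2. On a flip, F is the change 2 sigma_x of
  the spin sum.\<close>

lemma exchangeable_flips_ising:
  assumes n: "n \<ge> 2" and d: "d \<ge> 1"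
  defines "N \<equiv> real (card (torus d n))"
  shows "exchangeable_flips (configs d n) (torus d n) (pmf (ising d n \<beta>)) flip
    (\<lambda>x \<sigma>. (1 - \<sigma> x * tanh (\<beta> * local_field d n x \<sigma>)) / (2 * N)) (\<lambda>x \<sigma>. 2 * \<sigma> x)
    (statistic d n \<beta>) (2 * bcoeff d \<beta> / N)"
proof
  have N: "N > 0" using n by (simp add: N_def card_torus)
  let ?t = "\<lambda>x \<sigma>. tanh (\<beta> * local_field d n x \<sigma>)"
  have range: "\<sigma> x * ?t x \<sigma> \<in> {-1<..<1}" if "x \<in> torus d n" "\<sigma> \<in> configs d n" for x \<sigma>
    using configs_values[OF that(2,1)] tanh_real_bounds[of "\<beta> * local_field d n x \<sigma>"] by auto
  show "sum (pmf (ising d n \<beta>)) (configs d n) = 1"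
    by (rule sum_pmf_eq_1) (auto simp: set_pmf_eq pmf_ising split: if_splits)
  show "flip x \<sigma> \<in> configs d n" if "x \<in> torus d n" "\<sigma> \<in> configs d n" for x \<sigma>
    using that by (rule flip_in_configs)
  show "0 \<le> (1 - \<sigma> x * ?t x \<sigma>) / (2 * N)" if "x \<in> torus d n" "\<sigma> \<in> configs d n" for x \<sigma>
    using range[OF that] N by simp
  show "pmf (ising d n \<beta>) (flip x \<sigma>) * ((1 - flip x \<sigma> x * ?t x (flip x \<sigma>)) / (2 * N))
      = pmf (ising d n \<beta>) \<sigma> * ((1 - \<sigma> x * ?t x \<sigma>) / (2 * N))"
    if x: "x \<in> torus d n" and \<sigma>: "\<sigma> \<in> configs d n" for x \<sigma>
  proof -
    \<comment> \<open>The flip probability is proportional to \<open>1 - tanh ?z\<close>, and the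
      flip multiplies the Gibbs weight by \<open>exp (- (2 * ?z))\<close>, so reversibility becomes
      \<open>tanh_balance\<close>.\<close>
    let ?z = "\<beta> * (\<sigma> x * local_field d n x \<sigma>)"
    have "\<sigma> x * ?t x \<sigma> = tanh ?z"
      using configs_values[OF \<sigma> x] by auto
    moreover have "energy d n (flip x \<sigma>) = energy d n \<sigma> - 2 * (\<sigma> x * local_field d n x \<sigma>)"
      using energy_flip[OF n x, of \<sigma>] by simp
    then have "\<beta> * energy d n (flip x \<sigma>) = \<beta> * energy d n \<sigma> + - (2 * ?z)"
      by (simp add: right_diff_distrib)
    then have "exp (\<beta> * energy d n (flip x \<sigma>)) = exp (\<beta> * energy d n \<sigma>) * exp (- (2 * ?z))"
      by (simp only: exp_add)
    then have "pmf (ising d n \<beta>) (flip x \<sigma>) = pmf (ising d n \<beta>) \<sigma> * exp (- (2 * ?z))"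
      using \<sigma> flip_in_configs[OF x \<sigma>] by (simp add: pmf_ising)
    ultimately have "pmf (ising d n \<beta>) (flip x \<sigma>) * (1 - flip x \<sigma> x * ?t x (flip x \<sigma>))
        = pmf (ising d n \<beta>) \<sigma> * (exp (- (2 * ?z)) * (1 + tanh ?z))"
      by (simp add: local_field_flip[OF n x])
    also have "\<dots> = pmf (ising d n \<beta>) \<sigma> * (1 - \<sigma> x * ?t x \<sigma>)"
      using \<open>\<sigma> x * ?t x \<sigma> = tanh ?z\<close> by (simp only: tanh_balance)
    finally show ?thesis by simp
  qed
  show "(\<Sum>x\<in>torus d n. (1 - \<sigma> x * ?t x \<sigma>) / (2 * N) * (2 * \<sigma> x)) = statistic d n \<beta> \<sigma>"
    if \<sigma>: "\<sigma> \<in> configs d n" for \<sigma>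
    unfolding statistic_drift[OF order.trans[OF one_le_numeral n] d \<sigma>] N_def[symmetric]
  proof (rule sum.cong)
    fix x assume x: "x \<in> torus d n"
    show "(1 - \<sigma> x * ?t x \<sigma>) / (2 * N) * (2 * \<sigma> x) = (\<sigma> x - ?t x \<sigma>) / N"
      using configs_values[OF \<sigma> x] N by (auto simp: field_simps)
  qed simp
  show "(\<Sum>x\<in>torus d n. (1 - \<sigma> x * ?t x \<sigma>) / (2 * N) * \<bar>2 * \<sigma> x\<bar> *
      \<bar>statistic d n \<beta> \<sigma> - statistic d n \<beta> (flip x \<sigma>)\<bar>) \<le> 2 * (2 * bcoeff d \<beta> / N)"
    if \<sigma>: "\<sigma> \<in> configs d n" for \<sigma>
  proof -
    have "(\<Sum>x\<in>torus d n. (1 - \<sigma> x * ?t x \<sigma>) / (2 * N) * \<bar>2 * \<sigma> x\<bar> *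
        \<bar>statistic d n \<beta> \<sigma> - statistic d n \<beta> (flip x \<sigma>)\<bar>)
        \<le> (\<Sum>x\<in>torus d n. 1 / N * 2 * (2 * bcoeff d \<beta> / N))"
    proof (intro sum_mono mult_mono)
      fix x assume x: "x \<in> torus d n"
      \<comment> \<open>The crude bound |tanh| <= 1 caps the flip probability of a site by 1/N. Over
        N sites with |F| = 2 this gives 4b/N, twice the constant v = 2b/N.\<close>
      show "(1 - \<sigma> x * ?t x \<sigma>) / (2 * N) \<le> 1 / N"
        using range[OF x \<sigma>] N divide_right_mono[of "1 - \<sigma> x * ?t x \<sigma>" 2 "2 * N"] by simp
      show "\<bar>2 * \<sigma> x\<bar> \<le> 2"
        using configs_values[OF \<sigma> x] by auto
      show "\<bar>statistic d n \<beta> \<sigma> - statistic d n \<beta> (flip x \<sigma>)\<bar> \<le> 2 * bcoeff d \<beta> / N"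
        unfolding N_def using n by (intro statistic_flip x \<sigma>) simp
    qed (use N in auto)
    also have "\<dots> = 2 * (2 * bcoeff d \<beta> / N)"
      using N by (simp add: N_def[symmetric])
    finally show ?thesis .
  qed
qed auto

lemma statistic_concentration:
  assumes n: "n \<ge> 2" and d: "d \<ge> 1" and t: "t \<ge> 0"
  shows "measure_pmf.prob (ising d n \<beta>)
      {\<sigma>. sqrt (real (card (torus d n))) * \<bar>statistic d n \<beta> \<sigma>\<bar> \<ge> t}
    \<le> 2 * exp (- (t\<^sup>2 / (4 * bcoeff d \<beta>)))"
proof (cases "bcoeff d \<beta> = 0")
  \<comment> \<open>Division by zero makes the exponent 0, so the bound is 2, above any
    probability.\<close>
  case True
  then show ?thesis
    by (intro order.trans[OF measure_pmf.prob_le_1]) simp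
next
  case False
  let ?N = "real (card (torus d n))"
  let ?A = "{\<sigma>. sqrt ?N * \<bar>statistic d n \<beta> \<sigma>\<bar> \<ge> t}"
  have N: "?N > 0" using n by (simp add: card_torus)
  have b: "bcoeff d \<beta> > 0" using False bcoeff_nonneg[of d \<beta>] by simp
  have "measure_pmf.prob (ising d n \<beta>) ?A = measure_pmf.prob (ising d n \<beta>) (?A \<inter> set_pmf (ising d n \<beta>))"
    by (simp add: measure_Int_set_pmf)
  also have "\<dots> \<le> measure_pmf.prob (ising d n \<beta>) (?A \<inter> configs d n)"
    by (intro measure_pmf.finite_measure_mono) (auto simp: set_pmf_eq pmf_ising split: if_splits)
  also have "\<dots> = (\<Sum>\<sigma>\<in>?A \<inter> configs d n. pmf (ising d n \<beta>) \<sigma>)"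
    by (rule measure_measure_pmf_finite) simp
  also have "?A \<inter> configs d n = {\<sigma>. \<sigma> \<in> configs d n \<and> t / sqrt ?N \<le> \<bar>statistic d n \<beta> \<sigma>\<bar>}"
    using N by (auto simp: field_simps)
  \<comment> \<open>With s = t / sqrt N and v = 2b/N the exponent s^2/(2v) is t^2/(4b), free of
    N.\<close>
  also have "(\<Sum>\<sigma>\<in>\<dots>. pmf (ising d n \<beta>) \<sigma>)
      \<le> 2 * exp (- ((t / sqrt ?N)\<^sup>2 / (2 * (2 * bcoeff d \<beta> / ?N))))"
    using b N t by (intro exchangeable_flips.two_sided_tail_le[OF exchangeable_flips_ising[OF n d]]) auto
  also have "(t / sqrt ?N)\<^sup>2 / (2 * (2 * bcoeff d \<beta> / ?N)) = t\<^sup>2 / (4 * bcoeff d \<beta>)"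
    using N by (auto simp: power_divide)
  finally show ?thesis .
qed

theorem theorem17:
  fixes d :: nat
  assumes "d \<ge> 1"
  shows "(\<forall>n::nat. \<forall>\<beta>::real. \<forall>t::real. n \<ge> 2 \<longrightarrow> \<beta> \<ge> 0 \<longrightarrow> t \<ge> 0 \<longrightarrow>
            measure_pmf.prob (ising d n \<beta>)
              {\<sigma>. sqrt (real (card (torus d n))) *
                   \<bar>(1 - theta d 0 \<beta>) * magnetization d n \<sigma>
                     - (\<Sum>k=1..d - 1. theta d k \<beta> * nbr_corr d n (2 * k + 1) \<sigma>)\<bar> \<ge> t}
            \<le> 2 * exp (- (t\<^sup>2 / (4 * bcoeff d \<beta>))))
       \<and> (\<forall>\<beta>\<ge>0. theta d 0 \<beta> =
            (1 / 4 ^ (d - 1)) *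
              (\<Sum>k=1..d. real k * real ((2 * d) choose (d + k)) * tanh (2 * real k * \<beta>)))
       \<and> (d \<ge> 2 \<longrightarrow> (\<exists>\<beta>\<^sub>1>0. \<forall>\<beta>\<ge>0.
            (\<beta> < \<beta>\<^sub>1 \<longrightarrow> 1 - theta d 0 \<beta> > 0) \<and> (\<beta> > \<beta>\<^sub>1 \<longrightarrow> 1 - theta d 0 \<beta> < 0)))"
  using statistic_concentration[OF _ assms] theta_0_eq[OF assms] theta_0_threshold
  unfolding statistic_def by blast

end
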